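(* Let $\sigma$ be a sequent. (1) If $\sigma$ is valid over the class of epistemic frames, then $\sigma$ has a cyclic proof in $\mathrm{cICK}$. (2) If $\sigma$ is valid over the class of reflexive frames, then $\sigma$ has a cyclic proof in $\mathrm{cICKT}$. (3) If $\sigma$ is valid over the class of S4 frames, then $\sigma$ has a cyclic proof in $\mathrm{cICKS4}$.
   Context: Formulae over a finite non-empty set $\mathsf{A}$ of agents and atoms $\mathrm{Prop}$: $\varphi ::= \bot \mid p \mid \varphi\wedge\varphi\mid\varphi\vee\varphi\mid\varphi\to\varphi\mid K_a\varphi\mid C\varphi$. Semantics: an epistemic frame $(\mathcal{W},\leq,\{R_a\})$ has $\mathcal{W}\neq\emptyset$, $\leq$ a partial order, $R_a\subseteq\mathcal{W}^2$ with triangle confluence ($w\leq v$, $vR_au$ imply $wR_au$); reflexive/S4 frames have each $R_a$ reflexive / reflexive and transitive. Models add a $\leq$-monotone valuation; $w\models\varphi\to\psi$ iff for all $v\geq w$, $v\models\varphi$ implies $v\models\psi$; $w\models K_a\varphi$ iff all $R_a$-successors satisfy $\varphi$; $w\models C\varphi$ iff all $R^*$-successors satisfy $\varphi$ ($R^*$ reflexive–transitive closure of $\bigcup_aR_a$); atoms, $\bot,\wedge,\vee$ as usual. Sequents: annotated formulae $\varphi^x$, $x\in\{\mathsf{u},\mathsf{f}\}$; $\Gamma^-=\{\varphi:\varphi^x\in\Gamma\}$; $K_a\Gamma=\{(K_a\psi)^x:\psi^x\in\Gamma\}$. A sequent $\Gamma\Rightarrow\Delta$ has finite sets of annotated formulae,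 all of $\Gamma$ unfocused, at most one focused formula in $\Delta$, of form $C\psi$ or $K_aC\psi$; valid over a class if $\bigwedge\Gamma^-\to\bigvee\Delta^-$ is. Rules (premises / conclusion; $x\in\{\mathsf{u},\mathsf{f}\}$; premises and conclusion must be sequents): axioms id: $\Gamma,\varphi^{\mathsf{u}}\Rightarrow\varphi^x,\Delta$, $\bot$: $\Gamma,\bot^{\mathsf{u}}\Rightarrow\Delta$; $\wedge$L: $\Gamma,\varphi^{\mathsf{u}},\psi^{\mathsf{u}}\Rightarrow\Delta$ / $\Gamma,(\varphi\wedge\psi)^{\mathsf{u}}\Rightarrow\Delta$; $\wedge$R: $\Gamma\Rightarrow\varphi^{\mathsf{u}},\Delta$, $\Gamma\Rightarrow\psi^{\mathsf{u}},\Delta$ / $\Gamma\Rightarrow(\varphi\wedge\psi)^{\mathsf{u}},\Delta$; $\vee$L: $\Gamma,\varphi^{\mathsf{u}}\Rightarrow\Delta$, $\Gamma,\psi^{\mathsf{u}}\Rightarrow\Delta$ / $\Gamma,(\varphi\vee\psi)^{\mathsf{u}}\Rightarrow\Delta$; $\vee$R: $\Gamma\Rightarrow\varphi^{\mathsf{u}},\psi^{\mathsf{u}},\Delta$ / $\Gamma\Rightarrow(\varphi\vee\psi)^{\mathsf{u}},\Delta$; $\to$L: $\Gamma\Rightarrow\varphi^{\mathsf{u}},\Delta$, $\Gamma,\psi^{\mathsf{u}}\Rightarrow\Delta$ / $\Gamma,(\varphi\to\psi)^{\mathsf{u}}\Rightarrow\Delta$; $\to$R: $\Gamma,\varphi^{\mathsf{u}}\Rightarrow\psi^{\mathsf{u}}$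 / $\Gamma\Rightarrow(\varphi\to\psi)^{\mathsf{u}},\Delta$; u: $\Gamma\Rightarrow\varphi^{\mathsf{u}},\Delta$ / $\Gamma\Rightarrow\varphi^{\mathsf{f}},\Delta$; f: $\Gamma\Rightarrow\varphi^{\mathsf{f}},\Delta$ / $\Gamma\Rightarrow\varphi^{\mathsf{u}},\Delta$; $\mathsf{K}_a$: $\Gamma\Rightarrow\varphi^x$ / $\Pi,K_a\Gamma\Rightarrow(K_a\varphi)^x,\Sigma$; $\mathsf{T}_a$: $\Gamma,\varphi^{\mathsf{u}}\Rightarrow\Delta$ / $\Gamma,(K_a\varphi)^{\mathsf{u}}\Rightarrow\Delta$; $\mathsf{S4}_a$: $K_a\Gamma\Rightarrow\varphi^x$ / $\Pi,K_a\Gamma\Rightarrow(K_a\varphi)^x,\Sigma$; CL: $\Gamma,\varphi^{\mathsf{u}},\{(K_aC\varphi)^{\mathsf{u}}\}_{a}\Rightarrow\Delta$ / $\Gamma,(C\varphi)^{\mathsf{u}}\Rightarrow\Delta$; CR: $\Gamma\Rightarrow\varphi^{\mathsf{u}},\Delta$ and for each $a$, $\Gamma\Rightarrow(K_aC\varphi)^x,\Delta$ / $\Gamma\Rightarrow(C\varphi)^x,\Delta$ ($C\varphi$ principal). $\mathrm{cICK}$: id, $\bot$, $\wedge$L/R, $\vee$L/R, $\to$L/R, u, f, $\mathsf{K}_a$, CL, CR; $\mathrm{cICKT}$ adds $\mathsf{T}_a$; $\mathrm{cICKS4}$ is $\mathrm{cICKT}$ with $\mathsf{K}_a$ replaced by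 $\mathsf{S4}_a$. A cyclic pre-proof of $\sigma$ is a finite tree labelled by sequents, root $\sigma$, each inner node and its children forming a rule instance. A path is successful if every sequent on it has a focused formula and it passes through at least one CR instance with principal formula in focus; a repetition $(u,v)$: distinct nodes, $v$ a descendant of $u$, same label; successful if the path $u$ to $v$ is. A cyclic proof: every leaf is an axiom instance or the upper node $v$ of some successful repetition $(u,v)$. *)

theory Defs
  imports
    "HOL-Library.Multiset"
    "HOL-Library.Sublist"
    "HOL-Library.Infinite_Typeclass"
begin

section \<open>Syntax and semantics\<close>

text \<open>Agents are the elements of a type of class \<^class>\<open>finite\<close>; like every type, it is non-empty.\<close>

datatype ('a, 'p) fm =
    Bot
  | Atom 'p
  | Conj "('a, 'p) fm" "('a, 'p) fm"
  | Disj "('a, 'p) fm" "('a, 'p) fm"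
  | Imp "('a, 'p) fm" "('a, 'p) fm"
  | K 'a "('a, 'p) fm"
  | CK "('a, 'p) fm"

record ('w, 'a) frame =
  worlds :: "'w set"
  leq :: "'w rel"
  rel :: "'a \<Rightarrow> 'w rel"

definition epistemic_frames :: "('w, 'a) frame set" where
  "epistemic_frames = {F. worlds F \<noteq> {} \<and> partial_order_on (worlds F) (leq F) \<and>
     (\<forall>a. rel F a \<subseteq> worlds F \<times> worlds F) \<and>
     (\<forall>a w v u. (w, v) \<in> leq F \<longrightarrow> (v, u) \<in> rel F a \<longrightarrow> (w, u) \<in> rel F a)}"

definition reflexive_frames :: "('w, 'a) frame set" where
  "reflexive_frames = {F \<in> epistemic_frames. \<forall>a. refl_on (worlds F) (rel F a)}"

definition S4_frames :: "('w, 'a) frame set" where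
  "S4_frames = {F \<in> epistemic_frames. \<forall>a. refl_on (worlds F) (rel F a) \<and> trans (rel F a)}"

definition monotone_valuation :: "('w, 'a) frame \<Rightarrow> ('w \<Rightarrow> 'p set) \<Rightarrow> bool" where
  "monotone_valuation F V \<longleftrightarrow> (\<forall>w v. (w, v) \<in> leq F \<longrightarrow> V w \<subseteq> V v)"

text \<open>On frames in \<^const>\<open>epistemic_frames\<close>, all successors of a world of \<open>F\<close> are worlds of \<open>F\<close>,
  so the quantifiers below need no explicit relativisation to \<open>worlds F\<close>.\<close>

primrec sat :: "('w, 'a) frame \<Rightarrow> ('w \<Rightarrow> 'p set) \<Rightarrow> 'w \<Rightarrow> ('a, 'p) fm \<Rightarrow> bool" where
  "sat F V w Bot \<longleftrightarrow> False"
| "sat F V w (Atom p) \<longleftrightarrow> p \<in> V w"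
| "sat F V w (Conj \<phi> \<psi>) \<longleftrightarrow> sat F V w \<phi> \<and> sat F V w \<psi>"
| "sat F V w (Disj \<phi> \<psi>) \<longleftrightarrow> sat F V w \<phi> \<or> sat F V w \<psi>"
| "sat F V w (Imp \<phi> \<psi>) \<longleftrightarrow> (\<forall>v. (w, v) \<in> leq F \<longrightarrow> sat F V v \<phi> \<longrightarrow> sat F V v \<psi>)"
| "sat F V w (K a \<phi>) \<longleftrightarrow> (\<forall>v. (w, v) \<in> rel F a \<longrightarrow> sat F V v \<phi>)"
| "sat F V w (CK \<phi>) \<longleftrightarrow> (\<forall>v. (w, v) \<in> (\<Union>a. rel F a)\<^sup>* \<longrightarrow> sat F V v \<phi>)"

definition valid_fm :: "('w, 'a) frame set \<Rightarrow> ('a, 'p) fm \<Rightarrow> bool" where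
  "valid_fm \<F> \<phi> \<longleftrightarrow>
     (\<forall>F \<in> \<F>. \<forall>V. monotone_valuation F V \<longrightarrow> (\<forall>w \<in> worlds F. sat F V w \<phi>))"


section \<open>Sequents\<close>

datatype annot = Unf | Foc

type_synonym ('a, 'p) afm = "('a, 'p) fm \<times> annot"

datatype ('a, 'p) sequent =
  Seq (lhs: "('a, 'p) afm set") (rhs: "('a, 'p) afm set") (infix \<open>\<turnstile>\<close> 50)

definition focusable :: "('a, 'p) fm \<Rightarrow> bool" where
  "focusable \<phi> \<longleftrightarrow> (\<exists>\<psi>. \<phi> = CK \<psi> \<or> (\<exists>a. \<phi> = K a (CK \<psi>)))"

definition is_sequent :: "('a, 'p) sequent \<Rightarrow> bool" where
  "is_sequent s \<longleftrightarrow> finite (lhs s) \<and> finite (rhs s) \<and>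
     (\<forall>\<phi> x. (\<phi>, x) \<in> lhs s \<longrightarrow> x = Unf) \<and>
     (\<forall>\<phi> \<psi>. (\<phi>, Foc) \<in> rhs s \<longrightarrow> (\<psi>, Foc) \<in> rhs s \<longrightarrow> \<phi> = \<psi>) \<and>
     (\<forall>\<phi>. (\<phi>, Foc) \<in> rhs s \<longrightarrow> focusable \<phi>)"

definition strip :: "('a, 'p) afm set \<Rightarrow> ('a, 'p) fm set" where
  "strip \<Gamma> = fst ` \<Gamma>"

text \<open>Conjunctions and disjunctions of finite sets: the order in which the formulae are
  listed is immaterial, see \<open>sat_Conj_set\<close> and \<open>sat_Disj_set\<close> below.\<close>

definition Conj_set :: "('a, 'p) fm set \<Rightarrow> ('a, 'p) fm" where
  "Conj_set X = foldr Conj (SOME \<phi>s. set \<phi>s = X \<and> distinct \<phi>s) (Imp Bot Bot)"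

definition Disj_set :: "('a, 'p) fm set \<Rightarrow> ('a, 'p) fm" where
  "Disj_set X = foldr Disj (SOME \<phi>s. set \<phi>s = X \<and> distinct \<phi>s) Bot"

definition valid_sequent :: "('w, 'a) frame set \<Rightarrow> ('a, 'p) sequent \<Rightarrow> bool" where
  "valid_sequent \<F> s \<longleftrightarrow>
     valid_fm \<F> (Imp (Conj_set (strip (lhs s))) (Disj_set (strip (rhs s))))"

lemma some_listing:
  assumes "finite X"
  shows "set (SOME xs. set xs = X \<and> distinct xs) = X"
  using someI_ex[OF finite_distinct_list[OF assms]] by simp

lemma sat_Conj_set:
  assumes "finite X"
  shows "sat F V w (Conj_set X) \<longleftrightarrow> (\<forall>\<phi> \<in> X. sat F V w \<phi>)"
proof -
  have "sat F V w (foldr Conj xs (Imp Bot Bot)) \<longleftrightarrow> (\<forall>\<phi> \<in> set xs. sat F V w \<phi>)" for xs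
    by (induction xs) auto
  then show ?thesis by (simp add: Conj_set_def some_listing[OF assms])
qed

lemma sat_Disj_set:
  assumes "finite X"
  shows "sat F V w (Disj_set X) \<longleftrightarrow> (\<exists>\<phi> \<in> X. sat F V w \<phi>)"
proof -
  have "sat F V w (foldr Disj xs Bot) \<longleftrightarrow> (\<exists>\<phi> \<in> set xs. sat F V w \<phi>)" for xs
    by (induction xs) auto
  then show ?thesis by (simp add: Disj_set_def some_listing[OF assms])
qed


section \<open>The calculi\<close>

datatype calculus = cICK | cICKT | cICKS4

definition K_set :: "'a \<Rightarrow> ('a, 'p) afm set \<Rightarrow> ('a, 'p) afm set" where
  "K_set a \<Gamma> = {(K a \<psi>, x) | \<psi> x. (\<psi>, x) \<in> \<Gamma>}"

inductive is_axiom :: "('a, 'p) sequent \<Rightarrow> bool" where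
  "is_axiom (insert (\<phi>, Unf) \<Gamma> \<turnstile> insert (\<phi>, x) \<Delta>)"
| "is_axiom (insert (Bot, Unf) \<Gamma> \<turnstile> \<Delta>)"

text \<open>\<open>CR_rule x M s\<close>: \<open>s\<close> is concluded from the premises \<open>M\<close> by the rule CR,
  where \<open>x\<close> is the annotation of the principal formula.\<close>

inductive CR_rule ::
    "annot \<Rightarrow> ('a::finite, 'p) sequent multiset \<Rightarrow> ('a, 'p) sequent \<Rightarrow> bool" where
  "CR_rule x
     (add_mset (\<Gamma> \<turnstile> insert (\<phi>, Unf) \<Delta>)
        {# \<Gamma> \<turnstile> insert (K a (CK \<phi>), x) \<Delta>. a \<in># mset_set UNIV #})
     (\<Gamma> \<turnstile> insert (CK \<phi>, x) \<Delta>)"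

text \<open>The requirement that premises and conclusions be sequents is imposed in \<open>pre_proof\<close>,
  on all labels of the tree. Contexts are sets, so \<open>\<Gamma>\<close> and \<open>\<Delta>\<close> may contain the principal formula.\<close>

inductive rule_instance ::
    "calculus \<Rightarrow> ('a::finite, 'p) sequent multiset \<Rightarrow> ('a, 'p) sequent \<Rightarrow> bool"
  for c :: calculus where
  ConjL: "rule_instance c
     {# insert (\<phi>, Unf) (insert (\<psi>, Unf) \<Gamma>) \<turnstile> \<Delta> #}
     (insert (Conj \<phi> \<psi>, Unf) \<Gamma> \<turnstile> \<Delta>)"
| ConjR: "rule_instance c
     {# \<Gamma> \<turnstile> insert (\<phi>, Unf) \<Delta>, \<Gamma> \<turnstile> insert (\<psi>, Unf) \<Delta> #}
     (\<Gamma> \<turnstile> insert (Conj \<phi> \<psi>, Unf) \<Delta>)"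
| DisjL: "rule_instance c
     {# insert (\<phi>, Unf) \<Gamma> \<turnstile> \<Delta>, insert (\<psi>, Unf) \<Gamma> \<turnstile> \<Delta> #}
     (insert (Disj \<phi> \<psi>, Unf) \<Gamma> \<turnstile> \<Delta>)"
| DisjR: "rule_instance c
     {# \<Gamma> \<turnstile> insert (\<phi>, Unf) (insert (\<psi>, Unf) \<Delta>) #}
     (\<Gamma> \<turnstile> insert (Disj \<phi> \<psi>, Unf) \<Delta>)"
| ImpL: "rule_instance c
     {# \<Gamma> \<turnstile> insert (\<phi>, Unf) \<Delta>, insert (\<psi>, Unf) \<Gamma> \<turnstile> \<Delta> #}
     (insert (Imp \<phi> \<psi>, Unf) \<Gamma> \<turnstile> \<Delta>)"
| ImpR: "rule_instance c
     {# insert (\<phi>, Unf) \<Gamma> \<turnstile> {(\<psi>, Unf)} #}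
     (\<Gamma> \<turnstile> insert (Imp \<phi> \<psi>, Unf) \<Delta>)"
| unfocus: "rule_instance c
     {# \<Gamma> \<turnstile> insert (\<phi>, Unf) \<Delta> #}
     (\<Gamma> \<turnstile> insert (\<phi>, Foc) \<Delta>)"
| focus: "rule_instance c
     {# \<Gamma> \<turnstile> insert (\<phi>, Foc) \<Delta> #}
     (\<Gamma> \<turnstile> insert (\<phi>, Unf) \<Delta>)"
| K: "c \<noteq> cICKS4 \<Longrightarrow> rule_instance c
     {# \<Gamma> \<turnstile> {(\<phi>, x)} #}
     (\<Pi> \<union> K_set a \<Gamma> \<turnstile> insert (K a \<phi>, x) \<Sigma>)"
| T: "c \<noteq> cICK \<Longrightarrow> rule_instance c
     {# insert (\<phi>, Unf) \<Gamma> \<turnstile> \<Delta> #}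
     (insert (K a \<phi>, Unf) \<Gamma> \<turnstile> \<Delta>)"
| S4: "c = cICKS4 \<Longrightarrow> rule_instance c
     {# K_set a \<Gamma> \<turnstile> {(\<phi>, x)} #}
     (\<Pi> \<union> K_set a \<Gamma> \<turnstile> insert (K a \<phi>, x) \<Sigma>)"
| CL: "rule_instance c
     {# insert (\<phi>, Unf) (range (\<lambda>a. (K a (CK \<phi>), Unf)) \<union> \<Gamma>) \<turnstile> \<Delta> #}
     (insert (CK \<phi>, Unf) \<Gamma> \<turnstile> \<Delta>)"
| CR: "CR_rule x M s \<Longrightarrow> rule_instance c M s"


section \<open>Cyclic proofs\<close>

datatype 'l tree = Node (label: 'l) (children: "'l tree list")

text \<open>Nodes are addressed by lists of child indices; the descendants of \<open>u\<close> are the nodes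
  with prefix \<open>u\<close>.\<close>

fun is_node :: "'l tree \<Rightarrow> nat list \<Rightarrow> bool" where
  "is_node t [] \<longleftrightarrow> True"
| "is_node t (i # p) \<longleftrightarrow> i < length (children t) \<and> is_node (children t ! i) p"

fun subtree :: "'l tree \<Rightarrow> nat list \<Rightarrow> 'l tree" where
  "subtree t [] = t"
| "subtree t (i # p) = subtree (children t ! i) p"

definition label_at :: "'l tree \<Rightarrow> nat list \<Rightarrow> 'l" where
  "label_at t v = label (subtree t v)"

definition child_labels :: "'l tree \<Rightarrow> nat list \<Rightarrow> 'l multiset" where
  "child_labels t v = mset (map label (children (subtree t v)))"

definition is_leaf :: "'l tree \<Rightarrow> nat list \<Rightarrow> bool" where
  "is_leaf t v \<longleftrightarrow> is_node t v \<and> children (subtree t v) = []"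

definition pre_proof ::
    "calculus \<Rightarrow> ('a::finite, 'p) sequent \<Rightarrow> ('a, 'p) sequent tree \<Rightarrow> bool" where
  "pre_proof c s t \<longleftrightarrow> label t = s \<and>
     (\<forall>v. is_node t v \<longrightarrow> is_sequent (label_at t v)) \<and>
     (\<forall>v. is_node t v \<longrightarrow> \<not> is_leaf t v \<longrightarrow> rule_instance c (child_labels t v) (label_at t v))"

definition has_focus :: "('a, 'p) sequent \<Rightarrow> bool" where
  "has_focus s \<longleftrightarrow> (\<exists>\<phi>. (\<phi>, Foc) \<in> rhs s)"

text \<open>The path from \<open>u\<close> to a descendant \<open>v\<close> consists of the nodes \<open>w\<close> between \<open>u\<close> and \<open>v\<close>; it passes
  through the rule instance at \<open>w\<close> if it contains both \<open>w\<close> and a child of \<open>w\<close>.\<close>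

definition successful_path ::
    "('a::finite, 'p) sequent tree \<Rightarrow> nat list \<Rightarrow> nat list \<Rightarrow> bool" where
  "successful_path t u v \<longleftrightarrow>
     (\<forall>w. prefix u w \<longrightarrow> prefix w v \<longrightarrow> has_focus (label_at t w)) \<and>
     (\<exists>w. prefix u w \<and> strict_prefix w v \<and> CR_rule Foc (child_labels t w) (label_at t w))"

definition repetition :: "'l tree \<Rightarrow> nat list \<Rightarrow> nat list \<Rightarrow> bool" where
  "repetition t u v \<longleftrightarrow> is_node t u \<and> is_node t v \<and> strict_prefix u v \<and>
     label_at t u = label_at t v"

definition cyclic_proof ::
    "calculus \<Rightarrow> ('a::finite, 'p) sequent \<Rightarrow> ('a, 'p) sequent tree \<Rightarrow> bool" where
  "cyclic_proof c s t \<longleftrightarrow> pre_proof c s t \<and>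
     (\<forall>v. is_leaf t v \<longrightarrow>
        is_axiom (label_at t v) \<or> (\<exists>u. repetition t u v \<and> successful_path t u v))"

end

theory Submission
  imports Defs
begin

text \<open>Contrapositively, an unprovable sequent has a finite countermodel. Its worlds are the left-hand
  sides of saturated unprovable sequents over a finite closed set of formulae. No cut is needed: truth
  of the left-hand side and falsity of every saturated right-hand side suffice. The only delicate case
  is \<open>C\<phi>\<close> on the right of an unprovable \<open>\<Gamma> \<Rightarrow> \<Delta>\<close>. If \<open>C\<phi>\<close> were true at \<open>\<Gamma>\<close>, keep it in focus and
  search for a proof: saturate on the left, apply CR, apply the modal rule to each premise
  \<open>K\<^sub>aC\<phi>\<close>, and repeat. The premise \<open>\<phi>\<close> of CR is always provable, because \<open>\<phi>\<close> is true at all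
  reachable worlds. As there are only finitely many sequents, every branch returns to the conclusion of
  an earlier CR instance, so that the search yields a cyclic proof of \<open>\<Gamma> \<Rightarrow> \<Delta>\<close>.\<close>

section \<open>Proofs with open leaves\<close>

text \<open>The sequents in \<open>G\<close> stand for conclusions of focused CR instances below the root; an open leaf
  labelled by one of them becomes the upper node of a successful repetition once that instance is
  attached below.\<close>

definition closed_upto ::
    "calculus \<Rightarrow> ('a::finite, 'p) sequent set \<Rightarrow> ('a, 'p) sequent \<Rightarrow> ('a, 'p) sequent tree \<Rightarrow> bool" where
  "closed_upto c G s t \<longleftrightarrow> pre_proof c s t \<and>
     (\<forall>v. is_leaf t v \<longrightarrow>
        is_axiom (label_at t v) \<or> (\<exists>u. repetition t u v \<and> successful_path t u v) \<or>
        label_at t v \<in> G \<and> (\<forall>w. prefix w v \<longrightarrow> has_focus (label_at t w)))"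

definition derivable ::
    "calculus \<Rightarrow> ('a::finite, 'p) sequent set \<Rightarrow> ('a, 'p) sequent \<Rightarrow> bool" where
  "derivable c G s \<longleftrightarrow> (\<exists>t. closed_upto c G s t)"

lemma derivable_empty: "derivable c {} s \<longleftrightarrow> (\<exists>t. cyclic_proof c s t)"
  by (auto simp: derivable_def closed_upto_def cyclic_proof_def)

lemma derivable_mono:
  assumes "derivable c G s" "G \<subseteq> H"
  shows "derivable c H s"
  using assms unfolding derivable_def closed_upto_def by blast

section \<open>Attaching a new root below trees with open leaves\<close>

lemma label_at_simps [simp]:
  "label_at t [] = label t"
  "label_at (Node s ts) (i # v) = label_at (ts ! i) v"
  by (simp_all add: label_at_def)

lemma child_labels_simps [simp]:
  "child_labels (Node s ts) [] = mset (map label ts)"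
  "child_labels (Node s ts) (i # v) = child_labels (ts ! i) v"
  by (simp_all add: child_labels_def)

lemma is_leaf_simps [simp]:
  "is_leaf (Node s ts) [] \<longleftrightarrow> ts = []"
  "is_leaf (Node s ts) (i # v) \<longleftrightarrow> i < length ts \<and> is_leaf (ts ! i) v"
  by (auto simp: is_leaf_def)

lemma derivable_leaf:
  assumes "is_sequent s" "is_axiom s \<or> s \<in> G \<and> has_focus s"
  shows "derivable c G s"
proof -
  have "is_node (Node s []) v \<longleftrightarrow> v = []" for v :: "nat list" by (cases v) auto
  then have "closed_upto c G s (Node s [])"
    using assms by (auto simp: closed_upto_def pre_proof_def is_leaf_def)
  then show ?thesis by (auto simp: derivable_def)
qed

lemma successful_path_Cons:
  assumes "successful_path (ts ! i) u v"
  shows "successful_path (Node s ts) (i # u) (i # v)"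
proof -
  obtain w where "prefix u w" "strict_prefix w v" "CR_rule Foc (child_labels (ts ! i) w) (label_at (ts ! i) w)"
    using assms by (auto simp: successful_path_def)
  then have "\<exists>w. prefix (i # u) w \<and> strict_prefix w (i # v) \<and>
      CR_rule Foc (child_labels (Node s ts) w) (label_at (Node s ts) w)"
    by (intro exI[of _ "i # w"]) auto
  moreover have "has_focus (label_at (Node s ts) w)" if "prefix (i # u) w" "prefix w (i # v)" for w
    using that assms by (cases w) (auto simp: successful_path_def)
  ultimately show ?thesis by (auto simp: successful_path_def)
qed

lemma rule_instance_nonempty: "rule_instance c M s \<Longrightarrow> M \<noteq> {#}"
  by (auto elim!: rule_instance.cases CR_rule.cases)

text \<open>Leaves of the subtrees that are open for \<open>H\<close> either stay open for
  \<open>G\<close>, or carry \<open>s\<close> itself and are closed by the new root. Both cases need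
  focus at the root, to prolong the focused path inside the subtree; an empty \<open>H\<close>
  leaves the annotations of \<open>s\<close> unconstrained.\<close>

lemma closed_upto_Node:
  assumes s: "is_sequent s"
    and rule: "rule_instance c (mset (map label ts)) s"
    and ts: "\<And>t. t \<in> set ts \<Longrightarrow> closed_upto c H (label t) t"
    and H: "\<And>g. g \<in> H \<Longrightarrow> has_focus s \<and> (g \<in> G \<or> g = s \<and> CR_rule Foc (mset (map label ts)) s)"
  shows "closed_upto c G s (Node s ts)"
  unfolding closed_upto_def
proof (intro conjI allI impI)
  let ?T = "Node s ts"
  have sub: "closed_upto c H (label (ts ! i)) (ts ! i)" if "i < length ts" for i
    using ts that by simp
  have "is_sequent (label_at ?T v)" if "is_node ?T v" for v
    using that s sub by (cases v) (auto simp: closed_upto_def pre_proof_def)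
  moreover have "rule_instance c (child_labels ?T v) (label_at ?T v)"
    if "is_node ?T v" "\<not> is_leaf ?T v" for v
    using that rule sub by (cases v) (auto simp: closed_upto_def pre_proof_def)
  ultimately show "pre_proof c s ?T" by (auto simp: pre_proof_def)
  fix v assume leaf: "is_leaf ?T v"
  have "ts \<noteq> []" using rule_instance_nonempty[OF rule] by auto
  with leaf obtain i v' where v: "v = i # v'" and i: "i < length ts" and v': "is_leaf (ts ! i) v'"
    by (cases v) auto
  have focus: "has_focus (label_at ?T w)"
    if "prefix w (i # v')" "has_focus s" "\<forall>w. prefix w v' \<longrightarrow> has_focus (label_at (ts ! i) w)" for w
    using that by (cases w) auto
  consider "is_axiom (label_at (ts ! i) v')"
    | u where "repetition (ts ! i) u v'" "successful_path (ts ! i) u v'"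
    | "label_at (ts ! i) v' \<in> H" "\<forall>w. prefix w v' \<longrightarrow> has_focus (label_at (ts ! i) w)"
    using sub[OF i] v' unfolding closed_upto_def by blast
  then show "is_axiom (label_at ?T v) \<or> (\<exists>u. repetition ?T u v \<and> successful_path ?T u v) \<or>
      label_at ?T v \<in> G \<and> (\<forall>w. prefix w v \<longrightarrow> has_focus (label_at ?T w))"
  proof cases
    case 1
    then show ?thesis by (simp add: v)
  next
    case 2
    then have "repetition ?T (i # u) v"
      using i by (auto simp: repetition_def v)
    then show ?thesis using successful_path_Cons[OF 2(2)] v by blast
  next
    case 3
    then have f: "has_focus s" and
      "label_at (ts ! i) v' \<in> G \<or> label_at (ts ! i) v' = s \<and> CR_rule Foc (mset (map label ts)) s"
      using H by auto
    then consider "label_at (ts ! i) v' \<in> G"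
      | "label_at (ts ! i) v' = s" "CR_rule Foc (mset (map label ts)) s" by blast
    then show ?thesis
    proof cases
      case 1
      then show ?thesis using focus f 3(2) by (auto simp: v)
    next
      case 2
      \<comment> \<open>The cycle starts at the new root, and the focused CR instance required on it
        is the one at the root, so the witness is the empty address.\<close>
      then have "repetition ?T [] v" using i v' by (auto simp: repetition_def v is_leaf_def)
      moreover have "successful_path ?T [] v"
        using 2 focus f 3(2) unfolding successful_path_def v
        by (auto intro!: exI[of _ "[]"])
      ultimately show ?thesis by blast
    qed
  qed
qed

lemma derivable_step:
  assumes "is_sequent s" "rule_instance c M s"
    and prem: "\<And>r. r \<in># M \<Longrightarrow> derivable c H r"
    and H: "\<And>g. g \<in> H \<Longrightarrow> has_focus s \<and> (g \<in> G \<or> g = s \<and> CR_rule Foc M s)"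
  shows "derivable c G s"
proof -
  obtain f where f: "\<And>r. r \<in># M \<Longrightarrow> closed_upto c H r (f r)"
    using prem unfolding derivable_def by metis
  obtain rs where rs: "mset rs = M" using ex_mset by blast
  have lab: "label (f r) = r" if "r \<in> set rs" for r
    using f[of r] that rs by (auto simp: closed_upto_def pre_proof_def)
  then have M: "mset (map label (map f rs)) = M"
    using rs by (auto simp: o_def cong: map_cong)
  have "closed_upto c G s (Node s (map f rs))"
    by (rule closed_upto_Node[where H = H]) (use assms M f lab rs in auto)
  then show ?thesis by (auto simp: derivable_def)
qed

lemma derivable_rule:
  assumes "is_sequent s" "rule_instance c M s" "has_focus s \<or> G = {}"
    and "\<And>r. r \<in># M \<Longrightarrow> derivable c G r"
  shows "derivable c G s"
  by (rule derivable_step[where H = G]) (use assms in auto)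

text \<open>This is where cycles are formed: a focused CR instance discharges its own conclusion as
  an open leaf above its premises.\<close>

lemma derivable_CR:
  assumes "is_sequent s" "CR_rule Foc M s" "has_focus s"
    and "\<And>r. r \<in># M \<Longrightarrow> derivable c (insert s G) r"
  shows "derivable c G s"
  by (rule derivable_step[OF assms(1) rule_instance.CR[OF assms(2)] assms(4)]) (use assms in auto)


section \<open>Provability and saturation\<close>

definition unf :: "('a, 'p) fm set \<Rightarrow> ('a, 'p) afm set" where
  "unf X = (\<lambda>\<phi>. (\<phi>, Unf)) ` X"

lemma unf_simps [simp]:
  "unf {} = {}" "unf (insert \<phi> X) = insert (\<phi>, Unf) (unf X)"
  "unf (X \<union> Y) = unf X \<union> unf Y" "(\<phi>, x) \<in> unf X \<longleftrightarrow> \<phi> \<in> X \<and> x = Unf"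
  "unf (range f) = range (\<lambda>i. (f i, Unf))"
  by (auto simp: unf_def)

lemma finite_unf [simp]: "finite X \<Longrightarrow> finite (unf X)"
  by (simp add: unf_def)

abbreviation prov :: "calculus \<Rightarrow> ('a::finite, 'p) fm set \<Rightarrow> ('a, 'p) fm set \<Rightarrow> bool" where
  "prov c \<Gamma> \<Delta> \<equiv> derivable c {} (unf \<Gamma> \<turnstile> unf \<Delta>)"

abbreviation foc_seq :: "('a, 'p) fm \<Rightarrow> ('a, 'p) fm set \<Rightarrow> ('a, 'p) fm set \<Rightarrow> ('a, 'p) sequent" where
  "foc_seq \<chi> \<Gamma> \<Delta> \<equiv> unf \<Gamma> \<turnstile> insert (\<chi>, Foc) (unf \<Delta>)"

lemma is_sequent_unf [simp]: "finite \<Gamma> \<Longrightarrow> finite \<Delta> \<Longrightarrow> is_sequent (unf \<Gamma> \<turnstile> unf \<Delta>)"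
  by (auto simp: is_sequent_def)

lemma is_sequent_foc_seq [simp]:
  "finite \<Gamma> \<Longrightarrow> finite \<Delta> \<Longrightarrow> focusable \<chi> \<Longrightarrow> is_sequent (foc_seq \<chi> \<Gamma> \<Delta>)"
  by (auto simp: is_sequent_def)

lemma has_focus_foc_seq [simp]: "has_focus (foc_seq \<chi> \<Gamma> \<Delta>)"
  by (auto simp: has_focus_def)

lemma focusable_simps [simp]: "focusable (CK \<phi>)" "focusable (K a (CK \<phi>))"
  by (auto simp: focusable_def)

lemma prov_rule:
  assumes "finite \<Gamma>" "finite \<Delta>" "rule_instance c M (unf \<Gamma> \<turnstile> unf \<Delta>)"
    and "\<And>r. r \<in># M \<Longrightarrow> derivable c {} r"
  shows "prov c \<Gamma> \<Delta>"
  by (rule derivable_rule[OF _ assms(3)]) (use assms in auto)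

text \<open>The left-hand side of the largest modal premise for \<open>K a \<phi>\<close> on the
  right. Keeping the boxes, as the S4 rule does, makes the accessibility relation built from it
  transitive.\<close>

definition succ_fms :: "calculus \<Rightarrow> 'a \<Rightarrow> ('a, 'p) fm set \<Rightarrow> ('a, 'p) fm set" where
  "succ_fms c a \<Gamma> = (if c = cICKS4 then {K a \<psi> | \<psi>. K a \<psi> \<in> \<Gamma>} else {\<psi>. K a \<psi> \<in> \<Gamma>})"

lemma succ_fms_mono: "\<Gamma> \<subseteq> \<Gamma>' \<Longrightarrow> succ_fms c a \<Gamma> \<subseteq> succ_fms c a \<Gamma>'"
  by (auto simp: succ_fms_def)

text \<open>K and S4 in one form. The weakening context \<open>\<Pi>\<close> is all of
  \<open>unf \<Gamma>\<close>, which absorbs the boxed formulae consumed by the rule.\<close>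

lemma K_rule_succ_fms:
  "rule_instance c {# unf (succ_fms c a \<Gamma>) \<turnstile> {(\<phi>, x)} #} (unf \<Gamma> \<turnstile> insert (K a \<phi>, x) \<Sigma>)"
proof (cases "c = cICKS4")
  case True
  have "K_set a (unf {\<psi>. K a \<psi> \<in> \<Gamma>}) = unf (succ_fms c a \<Gamma>)"
    using True by (auto simp: K_set_def succ_fms_def)
  moreover have "unf \<Gamma> \<union> unf (succ_fms c a \<Gamma>) = unf \<Gamma>"
    using True by (auto simp: succ_fms_def)
  ultimately show ?thesis
    using S4[OF True, of a "unf {\<psi>. K a \<psi> \<in> \<Gamma>}" \<phi> x "unf \<Gamma>" \<Sigma>] by simp
next
  case False
  then have "unf \<Gamma> \<union> K_set a (unf (succ_fms c a \<Gamma>)) = unf \<Gamma>"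
    by (auto simp: K_set_def succ_fms_def)
  then show ?thesis
    using K[OF False, of "unf (succ_fms c a \<Gamma>)" \<phi> x "unf \<Gamma>" a \<Sigma>] by simp
qed

text \<open>Only left rules are covered, and \<Delta> occurs only positively, so saturation survives
  enlarging the right-hand side. The right rules for conjunction and disjunction are handled by
  maximality in \<open>world_pair\<close>.\<close>

definition lsat :: "calculus \<Rightarrow> ('a, 'p) fm set \<Rightarrow> ('a, 'p) fm set \<Rightarrow> bool" where
  "lsat c \<Gamma> \<Delta> \<longleftrightarrow>
     (\<forall>\<phi> \<psi>. Conj \<phi> \<psi> \<in> \<Gamma> \<longrightarrow> \<phi> \<in> \<Gamma> \<and> \<psi> \<in> \<Gamma>) \<and>
     (\<forall>\<phi> \<psi>. Disj \<phi> \<psi> \<in> \<Gamma> \<longrightarrow> \<phi> \<in> \<Gamma> \<or> \<psi> \<in> \<Gamma>) \<and>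
     (\<forall>\<phi> \<psi>. Imp \<phi> \<psi> \<in> \<Gamma> \<longrightarrow> \<phi> \<in> \<Delta> \<or> \<psi> \<in> \<Gamma>) \<and>
     (\<forall>a \<phi>. c \<noteq> cICK \<longrightarrow> K a \<phi> \<in> \<Gamma> \<longrightarrow> \<phi> \<in> \<Gamma>) \<and>
     (\<forall>\<phi>. CK \<phi> \<in> \<Gamma> \<longrightarrow> \<phi> \<in> \<Gamma> \<and> (\<forall>a. K a (CK \<phi>) \<in> \<Gamma>))"

lemma lsatD:
  assumes "lsat c \<Gamma> \<Delta>"
  shows "Conj \<phi> \<psi> \<in> \<Gamma> \<Longrightarrow> \<phi> \<in> \<Gamma> \<and> \<psi> \<in> \<Gamma>" "Disj \<phi> \<psi> \<in> \<Gamma> \<Longrightarrow> \<phi> \<in> \<Gamma> \<or> \<psi> \<in> \<Gamma>"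
    "Imp \<phi> \<psi> \<in> \<Gamma> \<Longrightarrow> \<phi> \<in> \<Delta> \<or> \<psi> \<in> \<Gamma>" "c \<noteq> cICK \<Longrightarrow> K a \<phi> \<in> \<Gamma> \<Longrightarrow> \<phi> \<in> \<Gamma>"
    "CK \<phi> \<in> \<Gamma> \<Longrightarrow> \<phi> \<in> \<Gamma> \<and> K a (CK \<phi>) \<in> \<Gamma>"
proof -
  note l = assms[unfolded lsat_def]
  show "Conj \<phi> \<psi> \<in> \<Gamma> \<Longrightarrow> \<phi> \<in> \<Gamma> \<and> \<psi> \<in> \<Gamma>"
    using l[THEN conjunct1] by blast
  show "Disj \<phi> \<psi> \<in> \<Gamma> \<Longrightarrow> \<phi> \<in> \<Gamma> \<or> \<psi> \<in> \<Gamma>"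
    using l[THEN conjunct2, THEN conjunct1] by blast
  show "Imp \<phi> \<psi> \<in> \<Gamma> \<Longrightarrow> \<phi> \<in> \<Delta> \<or> \<psi> \<in> \<Gamma>"
    using l[THEN conjunct2, THEN conjunct2, THEN conjunct1] by blast
  show "c \<noteq> cICK \<Longrightarrow> K a \<phi> \<in> \<Gamma> \<Longrightarrow> \<phi> \<in> \<Gamma>"
    using l[THEN conjunct2, THEN conjunct2, THEN conjunct2, THEN conjunct1] by blast
  show "CK \<phi> \<in> \<Gamma> \<Longrightarrow> \<phi> \<in> \<Gamma> \<and> K a (CK \<phi>) \<in> \<Gamma>"
    using l[THEN conjunct2, THEN conjunct2, THEN conjunct2, THEN conjunct2] by blast
qed

lemma lsat_mono: "lsat c \<Gamma> \<Delta> \<Longrightarrow> \<Delta> \<subseteq> \<Delta>' \<Longrightarrow> lsat c \<Gamma> \<Delta>'"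
  unfolding lsat_def by blast

section \<open>Finite closed sets of formulae\<close>

primrec components :: "('a, 'p) fm \<Rightarrow> ('a, 'p) fm set" where
  "components Bot = {}"
| "components (Atom p) = {}"
| "components (Conj \<phi> \<psi>) = {\<phi>, \<psi>}"
| "components (Disj \<phi> \<psi>) = {\<phi>, \<psi>}"
| "components (Imp \<phi> \<psi>) = {\<phi>, \<psi>}"
| "components (K a \<phi>) = {\<phi>}"
| "components (CK \<phi>) = insert \<phi> (range (\<lambda>a. K a (CK \<phi>)))"

definition fm_closed :: "('a, 'p) fm set \<Rightarrow> bool" where
  "fm_closed X \<longleftrightarrow> (\<forall>\<chi> \<in> X. components \<chi> \<subseteq> X)"

lemma fm_closedD:
  assumes "fm_closed X"
  shows "Conj \<phi> \<psi> \<in> X \<Longrightarrow> \<phi> \<in> X \<and> \<psi> \<in> X" "Disj \<phi> \<psi> \<in> X \<Longrightarrow> \<phi> \<in> X \<and> \<psi> \<in> X"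
    "Imp \<phi> \<psi> \<in> X \<Longrightarrow> \<phi> \<in> X \<and> \<psi> \<in> X" "K a \<phi> \<in> X \<Longrightarrow> \<phi> \<in> X"
    "CK \<phi> \<in> X \<Longrightarrow> \<phi> \<in> X \<and> K a (CK \<phi>) \<in> X"
  using assms by (force simp: fm_closed_def)+

text \<open>A Fischer-Ladner closure. Unfolding \<open>CK \<phi>\<close> produces
  \<open>K a (CK \<phi>)\<close>, which is not a subformula, but whose only component is
  \<open>CK \<phi>\<close> again; finitely many agents keep the set finite.\<close>

primrec closure_fm :: "('a, 'p) fm \<Rightarrow> ('a, 'p) fm set" where
  "closure_fm Bot = {Bot}"
| "closure_fm (Atom p) = {Atom p}"
| "closure_fm (Conj \<phi> \<psi>) = insert (Conj \<phi> \<psi>) (closure_fm \<phi> \<union> closure_fm \<psi>)"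
| "closure_fm (Disj \<phi> \<psi>) = insert (Disj \<phi> \<psi>) (closure_fm \<phi> \<union> closure_fm \<psi>)"
| "closure_fm (Imp \<phi> \<psi>) = insert (Imp \<phi> \<psi>) (closure_fm \<phi> \<union> closure_fm \<psi>)"
| "closure_fm (K a \<phi>) = insert (K a \<phi>) (closure_fm \<phi>)"
| "closure_fm (CK \<phi>) = insert (CK \<phi>) (range (\<lambda>a. K a (CK \<phi>)) \<union> closure_fm \<phi>)"

lemma closure_fm_refl: "\<phi> \<in> closure_fm \<phi>"
  by (cases \<phi>) auto

lemma fm_closed_closure_fm: "fm_closed (closure_fm \<phi>)"
  by (induction \<phi>) (auto simp: fm_closed_def closure_fm_refl)

lemma finite_closure_fm: "finite (closure_fm (\<phi> :: ('a::finite, 'p) fm))"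
  by (induction \<phi>) auto

lemma ex_finite_fm_closed:
  fixes X :: "('a::finite, 'p) fm set"
  assumes "finite X"
  obtains Y where "finite Y" "fm_closed Y" "X \<subseteq> Y"
proof
  show "finite (\<Union>\<phi>\<in>X. closure_fm \<phi>)" using assms finite_closure_fm by blast
  show "fm_closed (\<Union>\<phi>\<in>X. closure_fm \<phi>)"
    using fm_closed_closure_fm unfolding fm_closed_def by blast
  show "X \<subseteq> (\<Union>\<phi>\<in>X. closure_fm \<phi>)" using closure_fm_refl by blast
qed

section \<open>Left saturation and right maximality\<close>

text \<open>A violated clause of \<open>lsat\<close> calls for a left rule whose premises keep the
  principal formula and strictly grow inside \<open>Cl\<close>. The parameter
  \<open>\<Theta>\<close> lets the same choice serve unfocused sequents and sequents with a focused
  formula on the right.\<close>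

lemma lsat_step:
  fixes \<Gamma> \<Delta> Cl :: "('a::finite, 'p) fm set"
  assumes "\<not> lsat c \<Gamma> \<Delta>" and sub: "\<Gamma> \<subseteq> Cl" "\<Delta> \<subseteq> Cl" and Cl: "fm_closed Cl"
  obtains N where
    "\<And>\<Gamma>' \<Delta>'. (\<Gamma>', \<Delta>') \<in># N \<Longrightarrow> \<Gamma> \<subseteq> \<Gamma>' \<and> \<Delta> \<subseteq> \<Delta>' \<and> \<Gamma>' \<subseteq> Cl \<and> \<Delta>' \<subseteq> Cl \<and> (\<Gamma>', \<Delta>') \<noteq> (\<Gamma>, \<Delta>)"
    "\<And>\<Theta>. rule_instance c {# unf \<Gamma>' \<turnstile> \<Theta> \<union> unf \<Delta>'. (\<Gamma>', \<Delta>') \<in># N #} (unf \<Gamma> \<turnstile> \<Theta> \<union> unf \<Delta>)"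
proof -
  \<comment> \<open>Contexts may contain the principal formula, so the conclusion of each rule below
    is over \<open>unf \<Gamma>\<close> itself.\<close>
  have unf_absorb: "insert (\<chi>, Unf) (unf \<Gamma>) = unf \<Gamma>" if "\<chi> \<in> \<Gamma>" for \<chi>
    using that by auto
  from assms(1) consider
      \<phi> \<psi> where "Conj \<phi> \<psi> \<in> \<Gamma>" "\<phi> \<notin> \<Gamma> \<or> \<psi> \<notin> \<Gamma>"
    | \<phi> \<psi> where "Disj \<phi> \<psi> \<in> \<Gamma>" "\<phi> \<notin> \<Gamma>" "\<psi> \<notin> \<Gamma>"
    | \<phi> \<psi> where "Imp \<phi> \<psi> \<in> \<Gamma>" "\<phi> \<notin> \<Delta>" "\<psi> \<notin> \<Gamma>"
    | a \<phi> where "c \<noteq> cICK" "K a \<phi> \<in> \<Gamma>" "\<phi> \<notin> \<Gamma>"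
    | \<phi> where "CK \<phi> \<in> \<Gamma>" "\<phi> \<notin> \<Gamma> \<or> (\<exists>a. K a (CK \<phi>) \<notin> \<Gamma>)"
    unfolding lsat_def by blast
  then show thesis
  proof cases
    case 1
    show ?thesis
    proof (rule that[of "{# (insert \<phi> (insert \<psi> \<Gamma>), \<Delta>) #}"])
      show "rule_instance c {# unf \<Gamma>' \<turnstile> \<Theta> \<union> unf \<Delta>'. (\<Gamma>', \<Delta>') \<in># {# (insert \<phi> (insert \<psi> \<Gamma>), \<Delta>) #} #}
          (unf \<Gamma> \<turnstile> \<Theta> \<union> unf \<Delta>)" for \<Theta>
        using ConjL[of c \<phi> \<psi> "unf \<Gamma>" "\<Theta> \<union> unf \<Delta>"] unf_absorb[OF 1(1)] by simp
    qed (use 1 sub fm_closedD(1)[OF Cl, of \<phi> \<psi>] in auto)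
  next
    case 2
    show ?thesis
    proof (rule that[of "{# (insert \<phi> \<Gamma>, \<Delta>), (insert \<psi> \<Gamma>, \<Delta>) #}"])
      show "rule_instance c {# unf \<Gamma>' \<turnstile> \<Theta> \<union> unf \<Delta>'. (\<Gamma>', \<Delta>') \<in># {# (insert \<phi> \<Gamma>, \<Delta>), (insert \<psi> \<Gamma>, \<Delta>) #} #}
          (unf \<Gamma> \<turnstile> \<Theta> \<union> unf \<Delta>)" for \<Theta>
        using DisjL[of c \<phi> "unf \<Gamma>" "\<Theta> \<union> unf \<Delta>" \<psi>] unf_absorb[OF 2(1)] by simp
    qed (use 2 sub fm_closedD(2)[OF Cl, of \<phi> \<psi>] in auto)
  next
    case 3
    show ?thesis
    proof (rule that[of "{# (\<Gamma>, insert \<phi> \<Delta>), (insert \<psi> \<Gamma>, \<Delta>) #}"])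
      show "rule_instance c {# unf \<Gamma>' \<turnstile> \<Theta> \<union> unf \<Delta>'. (\<Gamma>', \<Delta>') \<in># {# (\<Gamma>, insert \<phi> \<Delta>), (insert \<psi> \<Gamma>, \<Delta>) #} #}
          (unf \<Gamma> \<turnstile> \<Theta> \<union> unf \<Delta>)" for \<Theta>
        using ImpL[of c "unf \<Gamma>" \<phi> "\<Theta> \<union> unf \<Delta>" \<psi>] unf_absorb[OF 3(1)] by simp
    qed (use 3 sub fm_closedD(3)[OF Cl, of \<phi> \<psi>] in auto)
  next
    case 4
    show ?thesis
    proof (rule that[of "{# (insert \<phi> \<Gamma>, \<Delta>) #}"])
      show "rule_instance c {# unf \<Gamma>' \<turnstile> \<Theta> \<union> unf \<Delta>'. (\<Gamma>', \<Delta>') \<in># {# (insert \<phi> \<Gamma>, \<Delta>) #} #}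
          (unf \<Gamma> \<turnstile> \<Theta> \<union> unf \<Delta>)" for \<Theta>
        using T[OF 4(1), of \<phi> "unf \<Gamma>" "\<Theta> \<union> unf \<Delta>" a] unf_absorb[OF 4(2)] by simp
    qed (use 4 sub fm_closedD(4)[OF Cl, of a \<phi>] in auto)
  next
    case 5
    show ?thesis
    proof (rule that[of "{# (insert \<phi> (range (\<lambda>a. K a (CK \<phi>)) \<union> \<Gamma>), \<Delta>) #}"])
      show "rule_instance c {# unf \<Gamma>' \<turnstile> \<Theta> \<union> unf \<Delta>'. (\<Gamma>', \<Delta>') \<in>#
            {# (insert \<phi> (range (\<lambda>a. K a (CK \<phi>)) \<union> \<Gamma>), \<Delta>) #} #}
          (unf \<Gamma> \<turnstile> \<Theta> \<union> unf \<Delta>)" for \<Theta>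
        using CL[of c \<phi> "unf \<Gamma>" "\<Theta> \<union> unf \<Delta>"] unf_absorb[OF 5(1)] by simp
    qed (use 5 sub fm_closedD(5)[OF Cl, of \<phi>] in auto)
  qed
qed

text \<open>The termination measure of saturation counts the formulae of \<open>Cl\<close> still
  missing on either side.\<close>

lemma card_Diff_less:
  assumes "finite Cl" "\<Gamma> \<subseteq> \<Gamma>'" "\<Delta> \<subseteq> \<Delta>'" "\<Gamma>' \<subseteq> Cl" "\<Delta>' \<subseteq> Cl" "(\<Gamma>', \<Delta>') \<noteq> (\<Gamma>, \<Delta>)"
  shows "card (Cl - \<Gamma>') + card (Cl - \<Delta>') < card (Cl - \<Gamma>) + card (Cl - \<Delta>)"
proof -
  have "Cl - \<Gamma>' \<subset> Cl - \<Gamma> \<or> Cl - \<Delta>' \<subset> Cl - \<Delta>" using assms by blast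
  then have "card (Cl - \<Gamma>') < card (Cl - \<Gamma>) \<or> card (Cl - \<Delta>') < card (Cl - \<Delta>)"
    using assms(1) psubset_card_mono by (metis finite_Diff)
  moreover have "card (Cl - \<Gamma>') \<le> card (Cl - \<Gamma>)" "card (Cl - \<Delta>') \<le> card (Cl - \<Delta>)"
    using assms by (auto intro!: card_mono)
  ultimately show ?thesis by linarith
qed

lemma lsat_extension:
  fixes \<Gamma> \<Delta> Cl :: "('a::finite, 'p) fm set"
  assumes Cl: "finite Cl" "fm_closed Cl" and "\<Gamma> \<subseteq> Cl" "\<Delta> \<subseteq> Cl" "\<not> prov c \<Gamma> \<Delta>"
  shows "\<exists>\<Gamma>' \<Delta>'. \<Gamma> \<subseteq> \<Gamma>' \<and> \<Delta> \<subseteq> \<Delta>' \<and> \<Gamma>' \<subseteq> Cl \<and> \<Delta>' \<subseteq> Cl \<and> lsat c \<Gamma>' \<Delta>' \<and> \<not> prov c \<Gamma>' \<Delta>'"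
  using assms(3-)
proof (induction "card (Cl - \<Gamma>) + card (Cl - \<Delta>)" arbitrary: \<Gamma> \<Delta> rule: less_induct)
  case less
  show ?case
  proof (cases "lsat c \<Gamma> \<Delta>")
    case True
    then show ?thesis using less.prems by blast
  next
    case False
    obtain N where N: "\<And>\<Gamma>' \<Delta>'. (\<Gamma>', \<Delta>') \<in># N \<Longrightarrow>
        \<Gamma> \<subseteq> \<Gamma>' \<and> \<Delta> \<subseteq> \<Delta>' \<and> \<Gamma>' \<subseteq> Cl \<and> \<Delta>' \<subseteq> Cl \<and> (\<Gamma>', \<Delta>') \<noteq> (\<Gamma>, \<Delta>)"
      and rule: "\<And>\<Theta>. rule_instance c {# unf \<Gamma>' \<turnstile> \<Theta> \<union> unf \<Delta>'. (\<Gamma>', \<Delta>') \<in># N #} (unf \<Gamma> \<turnstile> \<Theta> \<union> unf \<Delta>)"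
      using lsat_step[OF False less.prems(1,2) Cl(2)] by blast
    have "finite \<Gamma>" "finite \<Delta>" using less.prems Cl(1) finite_subset by blast+
    \<comment> \<open>Were all premises provable, the rule would prove the conclusion;
      \<open>\<Theta>\<close> is empty since nothing is in focus.\<close>
    then obtain \<Gamma>' \<Delta>' where *: "(\<Gamma>', \<Delta>') \<in># N" "\<not> prov c \<Gamma>' \<Delta>'"
      using prov_rule[of \<Gamma> \<Delta> c, OF _ _ rule[of "{}", simplified]] less.prems(3) by fastforce
    note N' = N[OF *(1)]
    have "card (Cl - \<Gamma>') + card (Cl - \<Delta>') < card (Cl - \<Gamma>) + card (Cl - \<Delta>)"
      using card_Diff_less[OF Cl(1)] N' by blast
    from less.hyps[OF this] N' *(2) show ?thesis by (meson subset_trans)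
  qed
qed

text \<open>Maximality concerns the right-hand side with \<Gamma> fixed: it stands in for saturation
  under the right rules for conjunction and disjunction.\<close>

definition world_pair ::
    "calculus \<Rightarrow> ('a::finite, 'p) fm set \<Rightarrow> ('a, 'p) fm set \<Rightarrow> ('a, 'p) fm set \<Rightarrow> bool" where
  "world_pair c Cl \<Gamma> \<Delta> \<longleftrightarrow> \<Gamma> \<subseteq> Cl \<and> \<Delta> \<subseteq> Cl \<and> lsat c \<Gamma> \<Delta> \<and> \<not> prov c \<Gamma> \<Delta> \<and>
     (\<forall>X. X \<subseteq> Cl \<longrightarrow> \<Delta> \<subseteq> X \<longrightarrow> \<not> prov c \<Gamma> X \<longrightarrow> X = \<Delta>)"

text \<open>A maximal unprovable right-hand side exists because \<open>Cl\<close> is finite;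
  \<Gamma> is unchanged, and left saturation persists by \<open>lsat_mono\<close>.\<close>

lemma right_extension:
  fixes \<Gamma> \<Delta> Cl :: "('a::finite, 'p) fm set"
  assumes "finite Cl" "\<Gamma> \<subseteq> Cl" "\<Delta> \<subseteq> Cl" "lsat c \<Gamma> \<Delta>" "\<not> prov c \<Gamma> \<Delta>"
  shows "\<exists>\<Delta>'. \<Delta> \<subseteq> \<Delta>' \<and> world_pair c Cl \<Gamma> \<Delta>'"
proof -
  let ?S = "{X. X \<subseteq> Cl \<and> \<not> prov c \<Gamma> X}"
  have "finite ?S" using assms(1) by simp
  then obtain \<Delta>' where "\<Delta>' \<in> ?S" "\<Delta> \<subseteq> \<Delta>'" "\<forall>X \<in> ?S. \<Delta>' \<subseteq> X \<longrightarrow> \<Delta>' = X"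
    using finite_has_maximal2[of ?S \<Delta>] assms by blast
  then have "world_pair c Cl \<Gamma> \<Delta>'"
    using assms(2) lsat_mono[OF assms(4), of \<Delta>'] by (auto simp: world_pair_def)
  with \<open>\<Delta> \<subseteq> \<Delta>'\<close> show ?thesis by blast
qed

lemma world_pair_extension:
  fixes \<Gamma> \<Delta> Cl :: "('a::finite, 'p) fm set"
  assumes "finite Cl" "fm_closed Cl" "\<Gamma> \<subseteq> Cl" "\<Delta> \<subseteq> Cl" "\<not> prov c \<Gamma> \<Delta>"
  obtains \<Gamma>' \<Delta>' where "\<Gamma> \<subseteq> \<Gamma>'" "\<Delta> \<subseteq> \<Delta>'" "world_pair c Cl \<Gamma>' \<Delta>'"
  using lsat_extension[OF assms] right_extension[OF assms(1)] by (meson subset_trans)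

section \<open>The countermodel\<close>

text \<open>Persistence. By triangle confluence the modal successors of \<open>v\<close> are
  successors of \<open>w\<close>, so for \<open>CK\<close> only the empty path from \<open>v\<close>
  appeals to the induction hypothesis.\<close>

lemma sat_mono:
  assumes F: "F \<in> epistemic_frames" and V: "monotone_valuation F V"
    and "(w, v) \<in> leq F" "sat F V w \<phi>"
  shows "sat F V v \<phi>"
  using assms(3,4)
proof (induction \<phi> arbitrary: w v)
  case (Atom p)
  then show ?case using V by (auto simp: monotone_valuation_def)
next
  case (Imp \<phi> \<psi>)
  have "trans (leq F)" using F by (simp add: epistemic_frames_def partial_order_on_def preorder_on_def)
  then show ?case using Imp.prems by (auto dest: transD)
next
  case (K a \<phi>)
  have "(w, u) \<in> rel F a" if "(v, u) \<in> rel F a" for u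
    using F K.prems(1) that unfolding epistemic_frames_def by blast
  then show ?case using K.prems(2) by simp
next
  case (CK \<phi>)
  have tri: "(w, u) \<in> rel F a" if "(v, u) \<in> rel F a" for u a
    using F CK.prems(1) that unfolding epistemic_frames_def by blast
  have "sat F V u \<phi>" if "(v, u) \<in> (\<Union>a. rel F a)\<^sup>*" for u
    using that
  proof (cases rule: converse_rtranclE)
    case base
    then show ?thesis using CK by auto
  next
    case (step x)
    then have "(w, u) \<in> (\<Union>a. rel F a)\<^sup>*"
      using tri by (meson UN_iff converse_rtrancl_into_rtrancl)
    then show ?thesis using CK.prems(2) by simp
  qed
  then show ?case by simp
qed auto

text \<open>The right-hand sides of saturated pairs are discarded: several pairs may share a left-hand
  side, and only the latter determines the inclusion order and the accessibility relations. Keeping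
  the pairs as worlds would make the order fail antisymmetry.\<close>

locale countermodel =
  fixes c :: calculus and Cl :: "('a::finite, 'p) fm set" and e :: "('a, 'p) fm set \<Rightarrow> 'w"
  assumes finite_Cl: "finite Cl" and closed_Cl: "fm_closed Cl" and inj_e: "inj_on e (Pow Cl)"
begin

definition W :: "('a, 'p) fm set set" where
  "W = {\<Gamma>. \<exists>\<Delta>. world_pair c Cl \<Gamma> \<Delta>}"

definition F :: "('w, 'a) frame" where
  "F = \<lparr>worlds = e ` W,
        leq = {(e \<Gamma>, e \<Gamma>') | \<Gamma> \<Gamma>'. \<Gamma> \<in> W \<and> \<Gamma>' \<in> W \<and> \<Gamma> \<subseteq> \<Gamma>'},
        rel = (\<lambda>a. {(e \<Gamma>, e \<Gamma>') | \<Gamma> \<Gamma>'. \<Gamma> \<in> W \<and> \<Gamma>' \<in> W \<and> succ_fms c a \<Gamma> \<subseteq> \<Gamma>'})\<rparr>"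

definition V :: "'w \<Rightarrow> 'p set" where
  "V w = {p. \<exists>\<Gamma> \<in> W. w = e \<Gamma> \<and> Atom p \<in> \<Gamma>}"

lemma e_eq_iff: "\<Gamma> \<in> W \<Longrightarrow> \<Gamma>' \<in> W \<Longrightarrow> e \<Gamma> = e \<Gamma>' \<longleftrightarrow> \<Gamma> = \<Gamma>'"
  using inj_e by (auto simp: W_def world_pair_def inj_on_def)

lemma W_subset_Cl: "\<Gamma> \<in> W \<Longrightarrow> \<Gamma> \<subseteq> Cl"
  by (auto simp: W_def world_pair_def)

lemma leq_iff: "\<Gamma> \<in> W \<Longrightarrow> (e \<Gamma>, v) \<in> leq F \<longleftrightarrow> (\<exists>\<Gamma>' \<in> W. v = e \<Gamma>' \<and> \<Gamma> \<subseteq> \<Gamma>')"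
  by (auto simp: F_def e_eq_iff)

lemma rel_iff: "\<Gamma> \<in> W \<Longrightarrow> (e \<Gamma>, v) \<in> rel F a \<longleftrightarrow> (\<exists>\<Gamma>' \<in> W. v = e \<Gamma>' \<and> succ_fms c a \<Gamma> \<subseteq> \<Gamma>')"
  by (auto simp: F_def e_eq_iff)

lemma V_e [simp]: "\<Gamma> \<in> W \<Longrightarrow> V (e \<Gamma>) = {p. Atom p \<in> \<Gamma>}"
  by (auto simp: V_def e_eq_iff)

lemma monotone_V: "monotone_valuation F V"
  by (auto simp: monotone_valuation_def F_def)

text \<open>The implication clause of \<open>lsat\<close> is absent because it refers to the
  right-hand side, and a world fixes none.\<close>

lemma world_left:
  assumes "\<Gamma> \<in> W"
  shows "Conj \<phi> \<psi> \<in> \<Gamma> \<Longrightarrow> \<phi> \<in> \<Gamma> \<and> \<psi> \<in> \<Gamma>" "Disj \<phi> \<psi> \<in> \<Gamma> \<Longrightarrow> \<phi> \<in> \<Gamma> \<or> \<psi> \<in> \<Gamma>"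
    "c \<noteq> cICK \<Longrightarrow> K a \<phi> \<in> \<Gamma> \<Longrightarrow> \<phi> \<in> \<Gamma>" "CK \<phi> \<in> \<Gamma> \<Longrightarrow> \<phi> \<in> \<Gamma> \<and> K a (CK \<phi>) \<in> \<Gamma>"
proof -
  obtain \<Delta> where l: "lsat c \<Gamma> \<Delta>" using assms by (auto simp: W_def world_pair_def)
  show "Conj \<phi> \<psi> \<in> \<Gamma> \<Longrightarrow> \<phi> \<in> \<Gamma> \<and> \<psi> \<in> \<Gamma>" by (rule lsatD(1)[OF l])
  show "Disj \<phi> \<psi> \<in> \<Gamma> \<Longrightarrow> \<phi> \<in> \<Gamma> \<or> \<psi> \<in> \<Gamma>" by (rule lsatD(2)[OF l])
  show "c \<noteq> cICK \<Longrightarrow> K a \<phi> \<in> \<Gamma> \<Longrightarrow> \<phi> \<in> \<Gamma>" by (rule lsatD(4)[OF l])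
  show "CK \<phi> \<in> \<Gamma> \<Longrightarrow> \<phi> \<in> \<Gamma> \<and> K a (CK \<phi>) \<in> \<Gamma>" by (rule lsatD(5)[OF l])
qed

text \<open>Gives reflexivity. In cICKS4 the collected formulae are boxes already in \<Gamma>; in
  cICKT they lie in \<Gamma> by the saturation clause for the rule T.\<close>

lemma world_T:
  assumes "\<Gamma> \<in> W" "c \<noteq> cICK"
  shows "succ_fms c a \<Gamma> \<subseteq> \<Gamma>"
proof
  fix \<psi> assume "\<psi> \<in> succ_fms c a \<Gamma>"
  then have "\<psi> \<in> \<Gamma> \<or> K a \<psi> \<in> \<Gamma>" by (auto simp: succ_fms_def split: if_splits)
  then show "\<psi> \<in> \<Gamma>" using world_left(3)[OF assms, of a \<psi>] by blast
qed

text \<open>In cICKS4 the box itself moves to \<Gamma>', where the clause for T removes it;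
  otherwise \<open>succ_fms\<close> has already unboxed it.\<close>

lemma succ_fms_unbox:
  assumes "K a \<phi> \<in> \<Gamma>" "succ_fms c a \<Gamma> \<subseteq> \<Gamma>'" "\<Gamma>' \<in> W"
  shows "\<phi> \<in> \<Gamma>'"
proof (cases "c = cICKS4")
  case True
  then have "K a \<phi> \<in> \<Gamma>'" using assms(1,2) by (auto simp: succ_fms_def)
  then show ?thesis using world_left(3)[OF assms(3)] True by simp
next
  case False
  then show ?thesis using assms(1,2) by (auto simp: succ_fms_def)
qed

lemma succ_fms_trans:
  "c = cICKS4 \<Longrightarrow> succ_fms c a \<Gamma> \<subseteq> \<Gamma>' \<Longrightarrow> succ_fms c a \<Gamma>' \<subseteq> \<Gamma>'' \<Longrightarrow> succ_fms c a \<Gamma> \<subseteq> \<Gamma>''"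
  by (auto simp: succ_fms_def)

section \<open>Membership of the countermodel in the frame classes\<close>

text \<open>Triangle confluence reduces to monotonicity of \<open>succ_fms\<close>; antisymmetry
  holds because worlds are bare sets ordered by inclusion and \<open>e\<close> is injective on
  them.\<close>

lemma epistemic_F:
  assumes "W \<noteq> {}"
  shows "F \<in> epistemic_frames"
proof -
  have "partial_order_on (worlds F) (leq F)"
    unfolding partial_order_on_def preorder_on_def refl_on_def antisym_def trans_def
    by (auto simp: F_def e_eq_iff) blast+
  moreover have "(w, u) \<in> rel F a" if r: "(w, v) \<in> leq F" "(v, u) \<in> rel F a" for w v u a
  proof -
    obtain \<Gamma> where \<Gamma>: "\<Gamma> \<in> W" "w = e \<Gamma>" using r(1) by (auto simp: F_def)
    then obtain \<Gamma>' where \<Gamma>': "\<Gamma>' \<in> W" "v = e \<Gamma>'" "\<Gamma> \<subseteq> \<Gamma>'" using r(1) by (auto simp: leq_iff)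
    then obtain \<Gamma>'' where "\<Gamma>'' \<in> W" "u = e \<Gamma>''" "succ_fms c a \<Gamma>' \<subseteq> \<Gamma>''"
      using r(2) by (auto simp: rel_iff)
    then show ?thesis using \<Gamma> succ_fms_mono[OF \<Gamma>'(3), of c a] by (auto simp: rel_iff)
  qed
  ultimately show ?thesis using assms by (auto simp: epistemic_frames_def F_def)
qed

lemma reflexive_F:
  assumes "W \<noteq> {}" "c \<noteq> cICK"
  shows "F \<in> reflexive_frames"
proof -
  have "(w, w) \<in> rel F a" if w: "w \<in> worlds F" for w a
  proof -
    obtain \<Gamma> where "\<Gamma> \<in> W" "w = e \<Gamma>" using w by (auto simp: F_def)
    then show ?thesis using world_T assms(2) by (auto simp: rel_iff)
  qed
  then show ?thesis using epistemic_F[OF assms(1)] by (auto simp: reflexive_frames_def refl_on_def)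
qed

lemma S4_F: "W \<noteq> {} \<Longrightarrow> c = cICKS4 \<Longrightarrow> F \<in> S4_frames"
proof -
  assume *: "W \<noteq> {}" "c = cICKS4"
  have "trans (rel F a)" for a
  proof (rule transI)
    fix w v u assume r: "(w, v) \<in> rel F a" "(v, u) \<in> rel F a"
    obtain \<Gamma> where \<Gamma>: "\<Gamma> \<in> W" "w = e \<Gamma>" using r(1) by (auto simp: F_def)
    then obtain \<Gamma>' where \<Gamma>': "\<Gamma>' \<in> W" "v = e \<Gamma>'" "succ_fms c a \<Gamma> \<subseteq> \<Gamma>'"
      using r(1) by (auto simp: rel_iff)
    then obtain \<Gamma>'' where "\<Gamma>'' \<in> W" "u = e \<Gamma>''" "succ_fms c a \<Gamma>' \<subseteq> \<Gamma>''"
      using r(2) by (auto simp: rel_iff)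
    then show "(w, u) \<in> rel F a" using \<Gamma> succ_fms_trans[OF *(2) \<Gamma>'(3)] by (auto simp: rel_iff)
  qed
  moreover have "F \<in> reflexive_frames" using reflexive_F * by simp
  ultimately show ?thesis by (simp add: S4_frames_def reflexive_frames_def)
qed

section \<open>Cyclic proof search with common knowledge in focus\<close>

text \<open>\<open>refuted\<close> is the refutation half of the truth lemma for \<phi>, supplied
  there by induction; the last assumption is the invariant of the search. The outer induction counts
  the sequents not yet available as open leaves, the inner one bounds the saturation steps between
  two CR instances.\<close>

lemma foc_seq_derivable:
  assumes C: "CK \<phi> \<in> Cl"
    and refuted: "\<And>\<Gamma> \<Delta>. world_pair c Cl \<Gamma> \<Delta> \<Longrightarrow> \<phi> \<in> \<Delta> \<Longrightarrow> \<not> sat F V (e \<Gamma>) \<phi>"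
    and "\<Gamma> \<subseteq> Cl" "\<Delta> \<subseteq> Cl"
    and "\<And>\<Gamma>'. \<Gamma>' \<in> W \<Longrightarrow> \<Gamma> \<subseteq> \<Gamma>' \<Longrightarrow> sat F V (e \<Gamma>') (CK \<phi>)"
  shows "derivable c G (foc_seq (CK \<phi>) \<Gamma> \<Delta>)"
proof -
  \<comment> \<open>All conclusions of focused CR instances that the search can meet; they are
    finitely many, so \<open>G\<close> can grow only finitely often.\<close>
  define U where "U = (\<lambda>(\<Gamma>, \<Delta>). foc_seq (CK \<phi>) \<Gamma> \<Delta>) ` (Pow Cl \<times> Pow Cl)"
  have U: "finite U" using finite_Cl by (simp add: U_def)
  have fin: "finite X" if "X \<subseteq> Cl" for X using that finite_Cl finite_subset by blast
  show ?thesis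
    using assms(3-5)
  proof (induction "card (U - G)" arbitrary: G \<Gamma> \<Delta> rule: less_induct)
    case outer: less
    show ?case using outer.prems
    proof (induction "card (Cl - \<Gamma>) + card (Cl - \<Delta>)" arbitrary: \<Gamma> \<Delta> rule: less_induct)
      case inner: less
      let ?s = "foc_seq (CK \<phi>) \<Gamma> \<Delta>"
      have fin\<Gamma>: "finite \<Gamma>" "finite \<Delta>" using inner.prems fin by blast+
      \<comment> \<open>In turn: stop at an earlier conclusion, drop the focus, saturate further, or
        unfold by CR.\<close>
      consider "?s \<in> G" | "prov c \<Gamma> (insert (CK \<phi>) \<Delta>)" | "\<not> lsat c \<Gamma> \<Delta>"
        | "?s \<notin> G" "\<not> prov c \<Gamma> (insert (CK \<phi>) \<Delta>)" "lsat c \<Gamma> \<Delta>" by blast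
      then show ?case
      proof cases
        case 1
        then show ?thesis using fin\<Gamma> by (intro derivable_leaf) auto
      next
        case 2
        have "derivable c {} ?s"
          by (rule derivable_rule[OF _ unfocus[of c "unf \<Gamma>" "CK \<phi>" "unf \<Delta>"]]) (use fin\<Gamma> 2 in auto)
        then show ?thesis using derivable_mono by blast
      next
        case 3
        obtain N where N: "\<And>\<Gamma>' \<Delta>'. (\<Gamma>', \<Delta>') \<in># N \<Longrightarrow>
            \<Gamma> \<subseteq> \<Gamma>' \<and> \<Delta> \<subseteq> \<Delta>' \<and> \<Gamma>' \<subseteq> Cl \<and> \<Delta>' \<subseteq> Cl \<and> (\<Gamma>', \<Delta>') \<noteq> (\<Gamma>, \<Delta>)"
          and rule: "\<And>\<Theta>. rule_instance c {# unf \<Gamma>' \<turnstile> \<Theta> \<union> unf \<Delta>'. (\<Gamma>', \<Delta>') \<in># N #} (unf \<Gamma> \<turnstile> \<Theta> \<union> unf \<Delta>)"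
          using lsat_step[OF 3 inner.prems(1,2) closed_Cl] by blast
        have "derivable c G (foc_seq (CK \<phi>) \<Gamma>' \<Delta>')" if "(\<Gamma>', \<Delta>') \<in># N" for \<Gamma>' \<Delta>'
          using N[OF that] card_Diff_less[OF finite_Cl, of \<Gamma> \<Gamma>' \<Delta> \<Delta>'] inner.prems(3)
          by (intro inner.hyps) auto
        then show ?thesis
          using fin\<Gamma> by (intro derivable_rule[OF _ rule[of "{(CK \<phi>, Foc)}", simplified]]) auto
      next
        case 4
        \<comment> \<open>Unprovability with \<open>CK \<phi>\<close> on the right makes \<Gamma>
          itself a world, so \<open>CK \<phi>\<close> is true there and the modal steps below can
          start from it.\<close>
        obtain \<Delta>' where "world_pair c Cl \<Gamma> \<Delta>'"
          using right_extension[OF finite_Cl inner.prems(1), of "insert (CK \<phi>) \<Delta>" c]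
            4 inner.prems(2) C lsat_mono[OF 4(3), of "insert (CK \<phi>) \<Delta>"] by auto
        then have W: "\<Gamma> \<in> W" by (auto simp: W_def)
        let ?G = "insert ?s G"
        have "?s \<in> U" using inner.prems by (auto simp: U_def)
        then have less: "card (U - ?G) < card (U - G)"
          using U 4(1) by (intro psubset_card_mono) auto
        \<comment> \<open>If this were unprovable, some world above \<Gamma> would refute \<phi>,
          although \<open>CK \<phi>\<close> and hence \<phi> holds there.\<close>
        have "prov c \<Gamma> (insert \<phi> \<Delta>)"
        proof (rule ccontr)
          assume "\<not> prov c \<Gamma> (insert \<phi> \<Delta>)"
          moreover have "insert \<phi> \<Delta> \<subseteq> Cl"
            using fm_closedD(5)[OF closed_Cl C] inner.prems(2) by auto
          ultimately obtain \<Gamma>' \<Delta>' where *: "\<Gamma> \<subseteq> \<Gamma>'" "insert \<phi> \<Delta> \<subseteq> \<Delta>'" "world_pair c Cl \<Gamma>' \<Delta>'"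
            using world_pair_extension[OF finite_Cl closed_Cl inner.prems(1)] by metis
          then have "sat F V (e \<Gamma>') (CK \<phi>)" using inner.prems(3) by (auto simp: W_def)
          then show False using refuted[OF *(3)] *(2) by auto
        qed
        \<comment> \<open>This premise has lost the focus, so its proof must be one without open
          leaves.\<close>
        then have base: "derivable c ?G (unf \<Gamma> \<turnstile> insert (\<phi>, Unf) (unf \<Delta>))"
          using derivable_mono[where G = "{}"] by auto
        \<comment> \<open>The modal rule drops \<Delta> and keeps the focus. Worlds containing the
          new left-hand side are \<open>a\<close>-successors of \<Gamma>, so they inherit the truth
          of \<open>CK \<phi>\<close>.\<close>
        have step: "derivable c ?G (foc_seq (K a (CK \<phi>)) \<Gamma> \<Delta>)" for a
        proof (rule derivable_rule[OF _ K_rule_succ_fms])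
          have "derivable c ?G (foc_seq (CK \<phi>) (succ_fms c a \<Gamma>) {})"
          proof (rule outer.hyps[OF less])
            show "succ_fms c a \<Gamma> \<subseteq> Cl"
              using inner.prems(1) fm_closedD(4)[OF closed_Cl] by (auto simp: succ_fms_def)
            fix \<Gamma>' assume *: "\<Gamma>' \<in> W" "succ_fms c a \<Gamma> \<subseteq> \<Gamma>'"
            then have r: "(e \<Gamma>, e \<Gamma>') \<in> (\<Union>a. rel F a)" using rel_iff[OF W] by blast
            have "sat F V (e \<Gamma>) (CK \<phi>)" using inner.prems(3) W by blast
            then show "sat F V (e \<Gamma>') (CK \<phi>)"
              using converse_rtrancl_into_rtrancl[OF r] by auto
          qed simp
          then show "derivable c ?G r" if "r \<in># {# unf (succ_fms c a \<Gamma>) \<turnstile> {(CK \<phi>, Foc)} #}" for r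
            using that by simp
        qed (use fin\<Gamma> in auto)
        show ?thesis
        proof (rule derivable_CR[OF _ CR_rule.intros])
          show "derivable c ?G r" if "r \<in># add_mset (unf \<Gamma> \<turnstile> insert (\<phi>, Unf) (unf \<Delta>))
              {# foc_seq (K a (CK \<phi>)) \<Gamma> \<Delta>. a \<in># mset_set UNIV #}" for r
            using that base step by auto
        qed (use fin\<Gamma> in auto)
      qed
    qed
  qed
qed

section \<open>The truth lemma\<close>

text \<open>Both halves are proved together: implications on the left use refutation of their
  antecedents, implications on the right use truth of theirs.\<close>

lemma truth:
  "(\<forall>\<Gamma> \<in> W. \<phi> \<in> \<Gamma> \<longrightarrow> sat F V (e \<Gamma>) \<phi>) \<and>
   (\<forall>\<Gamma> \<Delta>. world_pair c Cl \<Gamma> \<Delta> \<longrightarrow> \<phi> \<in> \<Delta> \<longrightarrow> \<not> sat F V (e \<Gamma>) \<phi>)"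
proof -
  have W: "\<Gamma> \<in> W" if "world_pair c Cl \<Gamma> \<Delta>" for \<Gamma> \<Delta>
    using that by (auto simp: W_def)
  have fin: "finite \<Gamma>" "finite \<Delta>" if "world_pair c Cl \<Gamma> \<Delta>" for \<Gamma> \<Delta>
    using that finite_Cl finite_subset by (auto simp: world_pair_def)
  have unf_absorb: "insert (\<chi>, Unf) (unf X) = unf X" if "\<chi> \<in> X" for \<chi> and X :: "('a, 'p) fm set"
    using that by auto
  have axiom: "\<not> is_axiom (unf \<Gamma> \<turnstile> unf \<Delta>)" if "world_pair c Cl \<Gamma> \<Delta>" for \<Gamma> \<Delta>
    using derivable_leaf[of "unf \<Gamma> \<turnstile> unf \<Delta>" "{}" c] that fin[OF that] by (auto simp: world_pair_def)
  \<comment> \<open>Read backwards, a rule applied to a formula of \<Delta> has an unprovable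
    premise; the principal formula is absorbed into the context.\<close>
  have no_rule: "\<exists>r \<in># M. \<not> derivable c {} r"
    if "world_pair c Cl \<Gamma> \<Delta>" "rule_instance c M (unf \<Gamma> \<turnstile> insert (\<chi>, Unf) (unf \<Delta>))" "\<chi> \<in> \<Delta>" for \<Gamma> \<Delta> \<chi> M
    using that prov_rule[OF fin[OF that(1)], of c M] unf_absorb[OF that(3)]
    by (auto simp: world_pair_def)
  have rmax: "\<chi> \<in> \<Delta> \<or> prov c \<Gamma> (insert \<chi> \<Delta>)" if "world_pair c Cl \<Gamma> \<Delta>" "\<chi> \<in> Cl" for \<Gamma> \<Delta> \<chi>
    using that unfolding world_pair_def by (metis insert_iff insert_subset subset_insertI)
  have in_Cl: "\<chi> \<in> Cl" if "world_pair c Cl \<Gamma> \<Delta>" "\<chi> \<in> \<Delta>" for \<Gamma> \<Delta> \<chi>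
    using that by (auto simp: world_pair_def)
  show ?thesis
  proof (induction \<phi>)
    case Bot
    have "Bot \<notin> \<Gamma>" if "\<Gamma> \<in> W" for \<Gamma>
    proof
      assume "Bot \<in> \<Gamma>"
      from that obtain \<Delta> where wp: "world_pair c Cl \<Gamma> \<Delta>" by (auto simp: W_def)
      show False
        using axiom[OF wp] is_axiom.intros(2)[of "unf \<Gamma>" "unf \<Delta>"] unf_absorb[OF \<open>Bot \<in> \<Gamma>\<close>] by simp
    qed
    then show ?case by auto
  next
    case (Atom p)
    have "Atom p \<notin> \<Gamma>" if wp: "world_pair c Cl \<Gamma> \<Delta>" and "Atom p \<in> \<Delta>" for \<Gamma> \<Delta>
    proof
      assume "Atom p \<in> \<Gamma>"
      then show False
        using axiom[OF wp] is_axiom.intros(1)[of "Atom p" "unf \<Gamma>" Unf "unf \<Delta>"] that(2)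
        by (simp add: unf_absorb)
    qed
    then show ?case using W by auto
  next
    case (Conj \<phi> \<psi>)
    \<comment> \<open>If both conjuncts were missing from \<Delta>, maximality would make both
      premises of \<open>ConjR\<close> provable.\<close>
    have right: "\<phi> \<in> \<Delta> \<or> \<psi> \<in> \<Delta>" if wp: "world_pair c Cl \<Gamma> \<Delta>" and i: "Conj \<phi> \<psi> \<in> \<Delta>" for \<Gamma> \<Delta>
      using rmax[OF wp, of \<phi>] rmax[OF wp, of \<psi>] fm_closedD(1)[OF closed_Cl in_Cl[OF that]]
        no_rule[OF wp ConjR i] by auto
    show ?case
    proof (intro conjI ballI allI impI)
      fix \<Gamma> assume \<Gamma>: "\<Gamma> \<in> W" "Conj \<phi> \<psi> \<in> \<Gamma>"
      show "sat F V (e \<Gamma>) (Conj \<phi> \<psi>)" using world_left(1)[OF \<Gamma>] Conj \<Gamma>(1) by auto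
    next
      fix \<Gamma> \<Delta> assume wp: "world_pair c Cl \<Gamma> \<Delta>" "Conj \<phi> \<psi> \<in> \<Delta>"
      show "\<not> sat F V (e \<Gamma>) (Conj \<phi> \<psi>)" using right[OF wp] Conj wp(1) by auto
    qed
  next
    case (Disj \<phi> \<psi>)
    have right: "\<phi> \<in> \<Delta> \<and> \<psi> \<in> \<Delta>" if wp: "world_pair c Cl \<Gamma> \<Delta>" and i: "Disj \<phi> \<psi> \<in> \<Delta>" for \<Gamma> \<Delta>
    proof -
      have Cl: "\<phi> \<in> Cl" "\<psi> \<in> Cl" using fm_closedD(2)[OF closed_Cl in_Cl[OF that]] by auto
      have np: "\<not> prov c \<Gamma> (insert \<phi> (insert \<psi> \<Delta>))"
        using no_rule[OF wp DisjR i] by simp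
      have "insert \<phi> (insert \<psi> \<Delta>) \<subseteq> Cl" using wp Cl by (auto simp: world_pair_def)
      \<comment> \<open>The premise of \<open>DisjR\<close> is unprovable and extends \<Delta>
        inside \<open>Cl\<close>, so maximality forces equality.\<close>
      then have "insert \<phi> (insert \<psi> \<Delta>) = \<Delta>" using wp np unfolding world_pair_def by blast
      then show ?thesis by blast
    qed
    show ?case
    proof (intro conjI ballI allI impI)
      fix \<Gamma> assume \<Gamma>: "\<Gamma> \<in> W" "Disj \<phi> \<psi> \<in> \<Gamma>"
      show "sat F V (e \<Gamma>) (Disj \<phi> \<psi>)" using world_left(2)[OF \<Gamma>] Disj \<Gamma>(1) by auto
    next
      fix \<Gamma> \<Delta> assume wp: "world_pair c Cl \<Gamma> \<Delta>" "Disj \<phi> \<psi> \<in> \<Delta>"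
      show "\<not> sat F V (e \<Gamma>) (Disj \<phi> \<psi>)" using right[OF wp] Disj wp(1) by auto
    qed
  next
    case (Imp \<phi> \<psi>)
    show ?case
    proof (intro conjI ballI allI impI)
      fix \<Gamma> assume \<Gamma>: "\<Gamma> \<in> W" "Imp \<phi> \<psi> \<in> \<Gamma>"
      have "sat F V (e \<Gamma>') \<psi>" if \<Gamma>': "\<Gamma>' \<in> W" "\<Gamma> \<subseteq> \<Gamma>'" "sat F V (e \<Gamma>') \<phi>" for \<Gamma>'
      proof -
        \<comment> \<open>Any right-hand side paired with \<Gamma>' serves: \<open>lsat\<close> puts
          \<phi> on it, where it would be refuted, or \<psi> into \<Gamma>'.\<close>
        obtain \<Delta>' where wp: "world_pair c Cl \<Gamma>' \<Delta>'" using \<Gamma>'(1) by (auto simp: W_def)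
        then have "\<phi> \<in> \<Delta>' \<or> \<psi> \<in> \<Gamma>'"
          using \<Gamma>(2) \<Gamma>'(2) lsatD(3)[of c \<Gamma>' \<Delta>' \<phi> \<psi>] by (auto simp: world_pair_def)
        then show ?thesis using Imp wp \<Gamma>' by blast
      qed
      then show "sat F V (e \<Gamma>) (Imp \<phi> \<psi>)" using \<Gamma> by (auto simp: leq_iff)
    next
      fix \<Gamma> \<Delta> assume wp: "world_pair c Cl \<Gamma> \<Delta>" and i: "Imp \<phi> \<psi> \<in> \<Delta>"
      \<comment> \<open>\<open>ImpR\<close> discards \<Delta>, so its unprovable premise is extended
        to a new world, which lies above \<Gamma>.\<close>
      have np: "\<not> prov c (insert \<phi> \<Gamma>) {\<psi>}"
        using no_rule[OF wp ImpR i] by simp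
      have "insert \<phi> \<Gamma> \<subseteq> Cl" "{\<psi>} \<subseteq> Cl"
        using fm_closedD(3)[OF closed_Cl in_Cl[OF wp i]] wp by (auto simp: world_pair_def)
      then obtain \<Gamma>' \<Delta>' where *: "insert \<phi> \<Gamma> \<subseteq> \<Gamma>'" "{\<psi>} \<subseteq> \<Delta>'" "world_pair c Cl \<Gamma>' \<Delta>'"
        using world_pair_extension[OF finite_Cl closed_Cl _ _ np] by metis
      then have "sat F V (e \<Gamma>') \<phi>" "\<not> sat F V (e \<Gamma>') \<psi>" using Imp W[OF *(3)] by auto
      moreover have "(e \<Gamma>, e \<Gamma>') \<in> leq F" using *(1) leq_iff[OF W[OF wp]] W[OF *(3)] by auto
      ultimately show "\<not> sat F V (e \<Gamma>) (Imp \<phi> \<psi>)" by auto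
    qed
  next
    case (K a \<phi>)
    show ?case
    proof (intro conjI ballI allI impI)
      fix \<Gamma> assume \<Gamma>: "\<Gamma> \<in> W" "K a \<phi> \<in> \<Gamma>"
      have "\<phi> \<in> \<Gamma>'" if "\<Gamma>' \<in> W" "succ_fms c a \<Gamma> \<subseteq> \<Gamma>'" for \<Gamma>'
        using that \<Gamma>(2) succ_fms_unbox by blast
      then show "sat F V (e \<Gamma>) (K a \<phi>)" using K \<Gamma> by (auto simp: rel_iff)
    next
      fix \<Gamma> \<Delta> assume wp: "world_pair c Cl \<Gamma> \<Delta>" and i: "K a \<phi> \<in> \<Delta>"
      \<comment> \<open>The modal premise likewise extends to a world, now an
        \<open>a\<close>-successor of \<Gamma>.\<close>
      have np: "\<not> prov c (succ_fms c a \<Gamma>) {\<phi>}"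
        using no_rule[OF wp K_rule_succ_fms i] by simp
      have "succ_fms c a \<Gamma> \<subseteq> Cl" "{\<phi>} \<subseteq> Cl"
        using fm_closedD(4)[OF closed_Cl] in_Cl[OF wp i] wp
        by (auto simp: world_pair_def succ_fms_def)
      then obtain \<Gamma>' \<Delta>' where *: "succ_fms c a \<Gamma> \<subseteq> \<Gamma>'" "{\<phi>} \<subseteq> \<Delta>'" "world_pair c Cl \<Gamma>' \<Delta>'"
        using world_pair_extension[OF finite_Cl closed_Cl _ _ np] by metis
      then have "\<not> sat F V (e \<Gamma>') \<phi>" using K by auto
      moreover have "(e \<Gamma>, e \<Gamma>') \<in> rel F a" using *(1) rel_iff[OF W[OF wp]] W[OF *(3)] by auto
      ultimately show "\<not> sat F V (e \<Gamma>) (K a \<phi>)" by auto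
    qed
  next
    case (CK \<phi>)
    show ?case
    proof (intro conjI ballI allI impI)
      fix \<Gamma> assume \<Gamma>: "\<Gamma> \<in> W" "CK \<phi> \<in> \<Gamma>"
      have lC: "\<phi> \<in> \<Gamma>'" "K a (CK \<phi>) \<in> \<Gamma>'" if "\<Gamma>' \<in> W" "CK \<phi> \<in> \<Gamma>'" for \<Gamma>' a
        using world_left(4)[OF that] by simp_all
      \<comment> \<open>Membership of \<open>CK \<phi>\<close> travels along every step, since
        saturation supplies \<open>K a (CK \<phi>)\<close> for each agent.\<close>
      have "\<exists>\<Gamma>' \<in> W. v = e \<Gamma>' \<and> CK \<phi> \<in> \<Gamma>'" if "(e \<Gamma>, v) \<in> (\<Union>a. rel F a)\<^sup>*" for v
        using that
      proof (induction rule: rtrancl_induct)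
        case base
        then show ?case using \<Gamma> by blast
      next
        case (step v u)
        then obtain \<Gamma>' a where \<Gamma>': "\<Gamma>' \<in> W" "v = e \<Gamma>'" "CK \<phi> \<in> \<Gamma>'" and "(v, u) \<in> rel F a" by blast
        then obtain \<Gamma>'' where \<Gamma>'': "\<Gamma>'' \<in> W" "u = e \<Gamma>''" "succ_fms c a \<Gamma>' \<subseteq> \<Gamma>''"
          using rel_iff[OF \<Gamma>'(1)] by auto
        then have "CK \<phi> \<in> \<Gamma>''"
          using lC(2)[OF \<Gamma>'(1,3), of a] succ_fms_unbox by blast
        then show ?case using \<Gamma>'' by blast
      qed
      then show "sat F V (e \<Gamma>) (CK \<phi>)" using CK lC(1) by fastforce
    next
      fix \<Gamma> \<Delta> assume wp: "world_pair c Cl \<Gamma> \<Delta>" and i: "CK \<phi> \<in> \<Delta>"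
      show "\<not> sat F V (e \<Gamma>) (CK \<phi>)"
      proof
        assume sat: "sat F V (e \<Gamma>) (CK \<phi>)"
        have "F \<in> epistemic_frames" using epistemic_F W[OF wp] by blast
        \<comment> \<open>Persistence carries the truth of \<open>CK \<phi>\<close> to all worlds
          above \<Gamma>, which is the invariant needed to start the search.\<close>
        then have good: "sat F V (e \<Gamma>') (CK \<phi>)" if "\<Gamma>' \<in> W" "\<Gamma> \<subseteq> \<Gamma>'" for \<Gamma>'
          using sat_mono[OF _ monotone_V _ sat] leq_iff[OF W[OF wp]] that by blast
        have "derivable c {} (foc_seq (CK \<phi>) \<Gamma> \<Delta>)"
          by (rule foc_seq_derivable) (use in_Cl[OF wp i] CK wp good in \<open>auto simp: world_pair_def\<close>)
        \<comment> \<open>The rule \<open>focus\<close> turns this derivation into a proof of the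
          unfocused pair, contradicting its unprovability.\<close>
        then show False using no_rule[OF wp focus i] by simp
      qed
    qed
  qed
qed

end

section \<open>Completeness of the three calculi\<close>

text \<open>At most one formula is in focus, so at most one use of the rule \<open>unfocus\<close>
  restores the annotations.\<close>

lemma derivable_unfocused:
  assumes s: "is_sequent (\<Gamma> \<turnstile> \<Delta>)" and d: "prov c (strip \<Gamma>) (strip \<Delta>)"
  shows "derivable c {} (\<Gamma> \<turnstile> \<Delta>)"
proof -
  have unf: "unf (strip X) = X" if "\<forall>\<phi>. (\<phi>, Foc) \<notin> X" for X :: "('a, 'b) afm set"
  proof -
    have "x = Unf" if "(\<phi>, x) \<in> X" for \<phi> x
      using that \<open>\<forall>\<phi>. (\<phi>, Foc) \<notin> X\<close> by (cases x) auto
    then show ?thesis by (force simp: unf_def strip_def)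
  qed
  have \<Gamma>: "unf (strip \<Gamma>) = \<Gamma>" using s by (intro unf) (auto simp: is_sequent_def)
  show ?thesis
  proof (cases "\<exists>\<chi>. (\<chi>, Foc) \<in> \<Delta>")
    case False
    then show ?thesis using d unf[of \<Delta>] \<Gamma> by auto
  next
    case True
    then obtain \<chi> where \<chi>: "(\<chi>, Foc) \<in> \<Delta>" by blast
    define \<Delta>' where "\<Delta>' = \<Delta> - {(\<chi>, Foc)}"
    have \<Delta>: "\<Delta> = insert (\<chi>, Foc) \<Delta>'" using \<chi> by (auto simp: \<Delta>'_def)
    have "unf (strip \<Delta>') = \<Delta>'" using s \<chi> by (intro unf) (auto simp: is_sequent_def \<Delta>'_def)
    then have "unf (strip \<Delta>) = insert (\<chi>, Unf) \<Delta>'" by (simp add: \<Delta> strip_def)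
    then show ?thesis
      using derivable_rule[OF s[unfolded \<Delta>] unfocus, of "{}" c] d \<Gamma> by (simp add: \<Delta>)
  qed
qed

text \<open>The worlds of the countermodel form a finite set, so they can be renamed inside any
  infinite type; this is why validity over frames on one fixed infinite type suffices.\<close>

lemma ex_inj_on_infinite:
  assumes "finite A"
  obtains e :: "'b \<Rightarrow> 'w::infinite" where "inj_on e A"
proof -
  obtain B :: "'w set" where "finite B" "card B = card A"
    using infinite_arbitrarily_large[OF infinite_UNIV] by blast
  then show ?thesis using that assms finite_same_card_bij bij_betw_imp_inj_on by metis
qed

text \<open>The argument is uniform in the calculus; \<open>in_class\<close> is what links the
  calculus to its frame class.\<close>

lemma completeness:
  fixes \<sigma> :: "('a::finite, 'p) sequent"
  assumes \<sigma>: "is_sequent \<sigma>" and valid: "valid_sequent \<F> \<sigma>"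
    and in_class: "\<And>Cl (e :: ('a, 'p) fm set \<Rightarrow> 'w::infinite).
      countermodel Cl e \<Longrightarrow> countermodel.W c Cl \<noteq> {} \<Longrightarrow> countermodel.F c Cl e \<in> \<F>"
  shows "\<exists>t. cyclic_proof c \<sigma> t"
proof -
  obtain \<Gamma> \<Delta> where \<sigma>_eq: "\<sigma> = (\<Gamma> \<turnstile> \<Delta>)" by (cases \<sigma>)
  have fin: "finite (strip \<Gamma>)" "finite (strip \<Delta>)"
    using \<sigma> by (auto simp: is_sequent_def \<sigma>_eq strip_def)
  then obtain Cl where Cl: "finite Cl" "fm_closed Cl" "strip \<Gamma> \<union> strip \<Delta> \<subseteq> Cl"
    using ex_finite_fm_closed[of "strip \<Gamma> \<union> strip \<Delta>"] by auto
  obtain e :: "('a, 'p) fm set \<Rightarrow> 'w" where "inj_on e (Pow Cl)"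
    using ex_inj_on_infinite[of "Pow Cl"] Cl(1) by auto
  then interpret countermodel c Cl e by unfold_locales (use Cl in auto)
  have "prov c (strip \<Gamma>) (strip \<Delta>)"
  proof (rule ccontr)
    assume "\<not> prov c (strip \<Gamma>) (strip \<Delta>)"
    then obtain \<Gamma>' \<Delta>' where *: "strip \<Gamma> \<subseteq> \<Gamma>'" "strip \<Delta> \<subseteq> \<Delta>'" "world_pair c Cl \<Gamma>' \<Delta>'"
      using world_pair_extension[OF Cl(1,2)] Cl(3) by (metis Un_subset_iff)
    then have W: "\<Gamma>' \<in> W" by (auto simp: W_def)
    then have "F \<in> \<F>" using in_class[OF countermodel_axioms] by blast
    \<comment> \<open>Reflexivity of the order allows the implication expressing the sequent to be
      evaluated at the world itself.\<close>
    moreover have "e \<Gamma>' \<in> worlds F" "(e \<Gamma>', e \<Gamma>') \<in> leq F" using W by (auto simp: F_def)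
    ultimately have "sat F V (e \<Gamma>') (Conj_set (strip \<Gamma>)) \<longrightarrow> sat F V (e \<Gamma>') (Disj_set (strip \<Delta>))"
      using valid monotone_V by (auto simp: valid_sequent_def valid_fm_def \<sigma>_eq)
    then have "(\<forall>\<phi> \<in> strip \<Gamma>. sat F V (e \<Gamma>') \<phi>) \<longrightarrow> (\<exists>\<phi> \<in> strip \<Delta>. sat F V (e \<Gamma>') \<phi>)"
      using fin by (simp add: sat_Conj_set sat_Disj_set)
    then show False using truth * W by blast
  qed
  then have "derivable c {} \<sigma>" using derivable_unfocused \<sigma> by (simp add: \<sigma>_eq)
  then show ?thesis by (simp add: derivable_empty)
qed

theorem mainTheorem15:
  fixes \<sigma> :: "('a::finite, 'p) sequent"
  assumes "is_sequent \<sigma>"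
  shows "(valid_sequent (epistemic_frames :: ('w::infinite, 'a) frame set) \<sigma> \<longrightarrow>
            (\<exists>t. cyclic_proof cICK \<sigma> t)) \<and>
         (valid_sequent (reflexive_frames :: ('w, 'a) frame set) \<sigma> \<longrightarrow>
            (\<exists>t. cyclic_proof cICKT \<sigma> t)) \<and>
         (valid_sequent (S4_frames :: ('w, 'a) frame set) \<sigma> \<longrightarrow>
            (\<exists>t. cyclic_proof cICKS4 \<sigma> t))"
  using completeness[OF assms, of "epistemic_frames :: ('w, 'a) frame set" cICK]
    completeness[OF assms, of "reflexive_frames :: ('w, 'a) frame set" cICKT]
    completeness[OF assms, of "S4_frames :: ('w, 'a) frame set" cICKS4]
    countermodel.epistemic_F countermodel.reflexive_F countermodel.S4_F
  by blast

end
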